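(* Let $X$ be an uncountable compact metric space and let $C(X)$ be the Banach space of real-valued continuous functions on $X$ with the supremum norm. Then the set $$\{ f \in C(X) : \dim_{\mathrm H} f(X) = \dim_{\mathrm P} f(X) = 1 \}$$ is a 1-prevalent subset of $C(X)$.
   Context: $\dim_{\mathrm H}$ and $\dim_{\mathrm P}$ denote Hausdorff and packing dimension; $f(X)\subseteq\mathbb{R}$ carries the Euclidean metric. 1-prevalence: Let $Y$ be a Banach space. A one-dimensional subspace $P = \{\lambda \Phi : \lambda\in\mathbb{R}\}\subseteq Y$ (with $\Phi \in Y$, $\Phi\neq 0$) is called a probe for a Borel set $F \subseteq Y$ if $\mathcal{L}_P\big(Y\setminus (F+y)\big)=0$ for all $y\in Y$, where $\mathcal{L}_P = \mathcal{L}^1\circ\pi_P^{-1}$ is the push forward of one-dimensional Lebesgue measure $\mathcal{L}^1$ under $\pi_P:\mathbb{R}\to P$, $\pi_P(\lambda)=\lambda\Phi$ (regarded as a measure on $Y$ concentrated on $P$). A Borel set $F\subseteq Y$ is 1-prevalent if it admits a one-dimensional probe. In particular, asserting that a set is 1-prevalent in this sense includes asserting that it is Borel. *)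

theory Defs
  imports "HOL-Analysis.Analysis"
begin

section \<open>Hausdorff dimension\<close>

text \<open>
  The \<open>s\<close>-th power of the diameter of a bounded set, with the usual conventions for the
  exponent zero: the empty set contributes 0 and every nonempty set contributes 1.  (The case
  distinction is needed because \<open>0 powr 0 = 0\<close>, which would make the zero-dimensional measure of a
  singleton vanish.)
\<close>

definition diam_pow :: "real \<Rightarrow> 'a::metric_space set \<Rightarrow> ennreal" where
  "diam_pow s U = (if U = {} then 0 else if s = 0 then 1 else ennreal (diameter U powr s))"

text \<open>The boundedness condition is needed because \<^const>\<open>diameter\<close> is unspecified on unbounded sets.\<close>

definition delta_cover :: "real \<Rightarrow> 'a::metric_space set \<Rightarrow> (nat \<Rightarrow> 'a set) \<Rightarrow> bool" where
  "delta_cover \<delta> A U \<longleftrightarrow> A \<subseteq> (\<Union>i. U i) \<and> (\<forall>i. bounded (U i) \<and> diameter (U i) \<le> \<delta>)"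

definition hausdorff_measure_delta :: "real \<Rightarrow> real \<Rightarrow> 'a::metric_space set \<Rightarrow> ennreal" where
  "hausdorff_measure_delta s \<delta> A = (INF U \<in> {U. delta_cover \<delta> A U}. \<Sum>i. diam_pow s (U i))"

definition hausdorff_measure :: "real \<Rightarrow> 'a::metric_space set \<Rightarrow> ennreal" where
  "hausdorff_measure s A = (SUP \<delta> \<in> {0<..}. hausdorff_measure_delta s \<delta> A)"

definition hausdorff_dim :: "'a::metric_space set \<Rightarrow> ennreal" where
  "hausdorff_dim A = Inf {ennreal s | s. 0 \<le> s \<and> hausdorff_measure s A = 0}"

section \<open>Packing dimension\<close>

text \<open>
  A packing is given by the centres and radii of its balls.  The size of a ball of radius \<open>r\<close> is
  taken to be \<open>2 * r\<close>, which on the real line is its diameter.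
\<close>

definition delta_packing :: "real \<Rightarrow> 'a::metric_space set \<Rightarrow> ('a \<times> real) set \<Rightarrow> bool" where
  "delta_packing \<delta> A P \<longleftrightarrow> countable P \<and> (\<forall>(x, r) \<in> P. x \<in> A \<and> 0 < r \<and> r \<le> \<delta>) \<and>
     disjoint_family_on (\<lambda>(x, r). cball x r) P"

definition packing_premeasure_delta :: "real \<Rightarrow> real \<Rightarrow> 'a::metric_space set \<Rightarrow> ennreal" where
  "packing_premeasure_delta s \<delta> A =
     (SUP P \<in> {P. delta_packing \<delta> A P}. \<Sum>\<^sub>\<infinity>(x, r) \<in> P. ennreal ((2 * r) powr s))"

definition packing_premeasure :: "real \<Rightarrow> 'a::metric_space set \<Rightarrow> ennreal" where
  "packing_premeasure s A = (INF \<delta> \<in> {0<..}. packing_premeasure_delta s \<delta> A)"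

definition packing_measure :: "real \<Rightarrow> 'a::metric_space set \<Rightarrow> ennreal" where
  "packing_measure s A = (INF E \<in> {E :: nat \<Rightarrow> 'a set. A \<subseteq> (\<Union>i. E i)}. \<Sum>i. packing_premeasure s (E i))"

definition packing_dim :: "'a::metric_space set \<Rightarrow> ennreal" where
  "packing_dim A = Inf {ennreal s | s. 0 \<le> s \<and> packing_measure s A = 0}"

section \<open>One-dimensional prevalence\<close>

definition line_measure :: "'b::banach \<Rightarrow> 'b measure" where
  "line_measure \<Phi> = distr lborel borel (\<lambda>t. t *\<^sub>R \<Phi>)"

text \<open>The probe is the line spanned by \<open>\<Phi>\<close>; rescaling \<open>\<Phi>\<close> does not change the null sets.\<close>

definition is_probe :: "'b::banach \<Rightarrow> 'b set \<Rightarrow> bool" where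
  "is_probe \<Phi> F \<longleftrightarrow> \<Phi> \<noteq> 0 \<and> (\<forall>y. emeasure (line_measure \<Phi>) (UNIV - (\<lambda>x. x + y) ` F) = 0)"

definition one_prevalent :: "'b::banach set \<Rightarrow> bool" where
  "one_prevalent F \<longleftrightarrow> F \<in> sets borel \<and> (\<exists>\<Phi>. is_probe \<Phi> F)"

section \<open>Continuous functions on a compact space\<close>

text \<open>
  For a compact space, the Banach space \<open>C(X)\<close> with the supremum norm is the library's space
  \<^typ>\<open>'a \<Rightarrow>\<^sub>C real\<close> of bounded continuous functions, since boundedness is then automatic.
\<close>

instance bcontfun :: (metric_space, banach) banach ..

lemma compact_continuous_bcontfun:
  fixes f :: "'a::metric_space \<Rightarrow> real"
  assumes "compact (UNIV :: 'a set)" "continuous_on UNIV f"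
  shows "f \<in> bcontfun"
  using compact_imp_bounded[OF compact_continuous_image[OF assms(2,1)]] assms(2)
  by (simp add: bcontfun_def)

end

theory Submission
  imports Defs
begin

text \<open>
  By a Cantor scheme, \<open>X\<close> carries a continuous function \<open>\<Phi>\<close> and a Borel map \<open>g\<close> from the unit interval
  to \<open>X\<close> with \<open>\<Phi> (g u) = u\<close>.  The line spanned by \<open>\<Phi>\<close> is a probe: for every \<open>f\<close>, the image of \<open>X\<close> under
  \<open>f + t \<Phi>\<close> contains the image of the unit interval under \<open>u \<mapsto> f (g u) + t u\<close>.  Averaging over bounded \<open>t\<close>,
  the \<open>s\<close>-energy of the image of Lebesgue measure under this map is controlled by the integral of
  \<open>\<bar>u - v\<bar> powr - p\<close> over the unit square, which is finite for \<open>s < p < 1\<close>.  So for almost every \<open>t\<close> the energy is finite,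
  and the image has positive \<open>s\<close>-dimensional Hausdorff measure for every \<open>s < 1\<close>.  On the line the
  packing dimension lies between the Hausdorff dimension and 1, so this settles both dimensions.
\<close>

section \<open>Null sets of Hausdorff measures\<close>

lemma ennreal_eq_0_iff_less: "x = 0 \<longleftrightarrow> (\<forall>\<epsilon>>0. x < ennreal \<epsilon>)"
proof (intro iffI allI impI)
  assume *: "\<forall>\<epsilon>>0. x < ennreal \<epsilon>"
  show "x = 0"
  proof (rule antisym)
    show "x \<le> 0"
      by (rule ennreal_le_epsilon) (use * in \<open>simp add: less_imp_le\<close>)
  qed simp
qed simp

lemma suminf_ennreal_half_powers:
  assumes "0 \<le> (c::real)"
  shows "(\<Sum>i. ennreal (c * (1/2) ^ Suc i)) = ennreal c"
  using sums_mult[OF power_half_series, of c] assms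
  by (intro suminf_ennreal_eq) (auto simp del: power_Suc)

text \<open>Dimensions depend only on which Hausdorff measures vanish, so the argument works with
  this criterion rather than with values of the measures.\<close>

lemma hausdorff_measure_eq_0_iff:
  "hausdorff_measure s A = 0 \<longleftrightarrow>
    (\<forall>\<delta>>0. \<forall>\<epsilon>>0. \<exists>U. delta_cover \<delta> A U \<and> (\<Sum>i. diam_pow s (U i)) < ennreal \<epsilon>)"
proof -
  have "hausdorff_measure s A = 0 \<longleftrightarrow> (\<forall>\<delta>>0. hausdorff_measure_delta s \<delta> A = 0)"
    unfolding hausdorff_measure_def
    unfolding bot_ennreal[symmetric] by (subst SUP_bot_conv) auto
  also have "\<dots> \<longleftrightarrow> (\<forall>\<delta>>0. \<forall>\<epsilon>>0. \<exists>U. delta_cover \<delta> A U \<and> (\<Sum>i. diam_pow s (U i)) < ennreal \<epsilon>)"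
    unfolding hausdorff_measure_delta_def ennreal_eq_0_iff_less INF_less_iff by auto
  finally show ?thesis .
qed

lemma diam_pow_antimono:
  assumes "bounded U" "diameter U \<le> 1" "0 \<le> s" "s \<le> s'"
  shows "diam_pow s' U \<le> diam_pow s U"
proof -
  have d: "0 \<le> diameter U" using assms by (simp add: diameter_ge_0)
  \<comment> \<open>This settles \<open>s = 0\<close>, where a nonempty set has weight 1 by
    convention.\<close>
  have "diameter U powr s' \<le> 1 powr s'"
    using assms d by (intro powr_mono2) auto
  moreover have "diameter U powr s' \<le> diameter U powr s"
    using assms d by (intro powr_mono')
  ultimately show ?thesis
    using assms by (auto simp: diam_pow_def ennreal_le_iff)
qed

text \<open>Capping the mesh at 1 ensures that a larger exponent does not increase any term of the
  covering sum.\<close>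

lemma hausdorff_measure_eq_0_mono:
  assumes "hausdorff_measure s A = 0" "0 \<le> s" "s \<le> s'"
  shows "hausdorff_measure s' A = 0"
  unfolding hausdorff_measure_eq_0_iff
proof (intro allI impI)
  fix \<delta> \<epsilon> :: real assume "\<delta> > 0" "\<epsilon> > 0"
  then obtain U where U: "delta_cover (min 1 \<delta>) A U" "(\<Sum>i. diam_pow s (U i)) < ennreal \<epsilon>"
    using assms(1) unfolding hausdorff_measure_eq_0_iff by (metis min_less_iff_conj zero_less_one)
  have "(\<Sum>i. diam_pow s' (U i)) \<le> (\<Sum>i. diam_pow s (U i))"
    using U assms by (intro suminf_le diam_pow_antimono) (auto simp: delta_cover_def)
  with U show "\<exists>U. delta_cover \<delta> A U \<and> (\<Sum>i. diam_pow s' (U i)) < ennreal \<epsilon>"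
    by (intro exI[of _ U]) (auto simp: delta_cover_def)
qed

lemma ball_diam_pow_le:
  assumes "0 < s" "0 < r"
  shows "diam_pow s (ball x r) \<le> ennreal ((2 * r) powr s)"
proof -
  have "diameter (ball x r) \<le> 2 * r"
  proof -
    have "dist y z \<le> 2 * r" if "y \<in> ball x r" "z \<in> ball x r" for y z
      using that dist_triangle3[of y z x] by auto
    then show ?thesis
      using assms by (auto simp: diameter_def intro!: cSUP_least)
  qed
  then show ?thesis using assms
    by (auto simp: diam_pow_def diameter_ge_0 intro!: ennreal_leI powr_mono2)
qed

text \<open>A ball centred in \<open>U\<close>, with radius twice the diameter \<open>d\<close> of
  \<open>U\<close>, contains \<open>U\<close> and has diameter at most \<open>4 * d\<close>; hence
  the factor \<open>4 powr s\<close>. A one-point set has \<open>d = 0\<close>, and the slack \<eta>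
  pays for a ball around it.\<close>

lemma open_superset_diam_pow:
  fixes U :: "'a::metric_space set"
  assumes "0 < s" "bounded U" "0 < \<eta>"
  obtains V where "open V" "bounded V" "U \<subseteq> V"
    "diam_pow s V \<le> ennreal (4 powr s) * diam_pow s U + ennreal \<eta>"
proof (cases "U = {}")
  case True
  then show ?thesis by (intro that[of "{}"]) (auto simp: diam_pow_def)
next
  case False
  then obtain x where x: "x \<in> U" by auto
  define d where "d = diameter U"
  have d: "0 \<le> d" using assms by (simp add: d_def diameter_ge_0)
  have le: "dist x y \<le> d" if "y \<in> U" for y
    unfolding d_def using assms x that by (intro diameter_bounded_bound)
  \<comment> \<open>For \<open>d = 0\<close> the radius solves
    \<open>(2 * r) powr s = \<eta>\<close>.\<close>
  define r where "r = (if d = 0 then \<eta> powr (1/s) / 2 else 2 * d)"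
  have r: "d < r" using assms d by (auto simp: r_def)
  have "ennreal ((2 * r) powr s) \<le> ennreal (4 powr s) * diam_pow s U + ennreal \<eta>"
  proof (cases "d = 0")
    case True
    then show ?thesis using assms by (auto simp: r_def powr_powr)
  next
    case False
    then have "ennreal ((2 * r) powr s) = ennreal (4 powr s) * diam_pow s U"
      using assms d \<open>U \<noteq> {}\<close>
      by (auto simp: r_def diam_pow_def d_def[symmetric] powr_mult ennreal_mult[symmetric])
    then show ?thesis by simp
  qed
  then show ?thesis
    using r d le assms x
    by (intro that[of "ball x r"]) (auto intro: order_trans[OF ball_diam_pow_le] simp: le_less_trans[OF le])
qed

text \<open>Making a cover open costs a constant factor, which vanishing absorbs. The mesh
  disappears because, for positive \<open>s\<close>, a small total forces every single diameter to
  be small. Open covers later give Borel measurability in the function and positive diameters in the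
  energy estimate.\<close>

lemma hausdorff_measure_eq_0_open_cover_iff:
  fixes A :: "'a::metric_space set"
  assumes s: "0 < s"
  shows "hausdorff_measure s A = 0 \<longleftrightarrow>
    (\<forall>\<epsilon>>0. \<exists>V :: nat \<Rightarrow> 'a set. (\<forall>i. open (V i) \<and> bounded (V i)) \<and> A \<subseteq> (\<Union>i. V i) \<and>
       (\<Sum>i. diam_pow s (V i)) < ennreal \<epsilon>)" (is "_ \<longleftrightarrow> ?R")
proof
  assume H: "hausdorff_measure s A = 0"
  show ?R
  proof (intro allI impI)
    fix \<epsilon> :: real assume e: "\<epsilon> > 0"
    define c :: real where "c = 4 powr s"
    have c: "c > 0" by (simp add: c_def)
    obtain U where U: "delta_cover 1 A U" "(\<Sum>i. diam_pow s (U i)) < ennreal (\<epsilon> / (2 * c))"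
      using H e c unfolding hausdorff_measure_eq_0_iff by (metis divide_pos_pos mult_pos_pos zero_less_numeral zero_less_one)
    \<comment> \<open>The enlargement errors are spread geometrically and add up to
      \<open>\<epsilon>/2\<close>; the factor \<open>c\<close> times the total of \<open>U\<close>
      stays below the other \<open>\<epsilon>/2\<close>.\<close>
    have "\<exists>V. open V \<and> bounded V \<and> U i \<subseteq> V \<and>
      diam_pow s V \<le> ennreal c * diam_pow s (U i) + ennreal (\<epsilon>/2 * (1/2)^Suc i)" for i
      using open_superset_diam_pow[OF s, of "U i" "\<epsilon>/2 * (1/2)^Suc i"] U e
      unfolding c_def delta_cover_def by (metis divide_pos_pos mult_pos_pos zero_less_numeral zero_less_one zero_less_power)
    then obtain V where V: "\<And>i. open (V i)" "\<And>i. bounded (V i)" "\<And>i. U i \<subseteq> V i"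
      "\<And>i. diam_pow s (V i) \<le> ennreal c * diam_pow s (U i) + ennreal (\<epsilon>/2 * (1/2)^Suc i)"
      by metis
    have "(\<Sum>i. diam_pow s (V i)) \<le> (\<Sum>i. ennreal c * diam_pow s (U i) + ennreal (\<epsilon>/2 * (1/2)^Suc i))"
      using V by (intro suminf_le) auto
    also have "\<dots> = ennreal c * (\<Sum>i. diam_pow s (U i)) + (\<Sum>i. ennreal (\<epsilon>/2 * (1/2)^Suc i))"
      by (subst suminf_add[symmetric]) auto
    also have "(\<Sum>i. ennreal (\<epsilon>/2 * (1/2)^Suc i)) = ennreal (\<epsilon>/2)"
      using e by (intro suminf_ennreal_half_powers) auto
    also have "ennreal c * (\<Sum>i. diam_pow s (U i)) + ennreal (\<epsilon>/2) < ennreal \<epsilon>"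
    proof -
      have "ennreal c * (\<Sum>i. diam_pow s (U i)) < ennreal c * ennreal (\<epsilon> / (2 * c))"
        using U c by (intro ennreal_mult_strict_left_mono) auto
      also have "\<dots> = ennreal (\<epsilon>/2)" using c e by (simp add: ennreal_mult[symmetric])
      finally have "ennreal c * (\<Sum>i. diam_pow s (U i)) + ennreal (\<epsilon>/2) < ennreal (\<epsilon>/2) + ennreal (\<epsilon>/2)"
        by (simp add: ennreal_add_left_cancel_less add.commute)
      also have "\<dots> = ennreal \<epsilon>" using e by (simp flip: ennreal_plus)
      finally show ?thesis .
    qed
    finally have "(\<Sum>i. diam_pow s (V i)) < ennreal \<epsilon>" .
    moreover have "A \<subseteq> (\<Union>i. V i)" using U V(3) unfolding delta_cover_def by blast
    ultimately show "\<exists>V :: nat \<Rightarrow> 'a set. (\<forall>i. open (V i) \<and> bounded (V i)) \<and> A \<subseteq> (\<Union>i. V i) \<and>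
       (\<Sum>i. diam_pow s (V i)) < ennreal \<epsilon>" using V by blast
  qed
next
  assume R: ?R
  show "hausdorff_measure s A = 0"
    unfolding hausdorff_measure_eq_0_iff
  proof (intro allI impI)
    fix \<delta> \<epsilon> :: real assume \<delta>: "\<delta> > 0" and \<epsilon>: "\<epsilon> > 0"
    \<comment> \<open>A total below \<open>\<delta> powr s\<close> keeps every diameter at most
      \<delta>.\<close>
    then obtain V :: "nat \<Rightarrow> 'a set" where V: "\<And>i. bounded (V i)" "A \<subseteq> (\<Union>i. V i)"
       "(\<Sum>i. diam_pow s (V i)) < ennreal (min \<epsilon> (\<delta> powr s))"
      using R[rule_format, of "min \<epsilon> (\<delta> powr s)"] by auto
    have "diameter (V i) \<le> \<delta>" for i
    proof (cases "V i = {}")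
      case False
      have "diam_pow s (V i) < ennreal (\<delta> powr s)"
        using ennreal_suminf_lessD[OF V(3), of i] by (rule less_le_trans) (simp add: ennreal_leI)
      then have "diameter (V i) powr s < \<delta> powr s"
        using False s by (simp add: diam_pow_def ennreal_less_iff)
      then show ?thesis using s \<delta> powr_mono2[of s \<delta> "diameter (V i)"] by linarith
    qed (use \<delta> in auto)
    then have "delta_cover \<delta> A V" using V by (auto simp: delta_cover_def)
    moreover have "(\<Sum>i. diam_pow s (V i)) < ennreal \<epsilon>"
      using V(3) by (rule less_le_trans) (simp add: ennreal_leI)
    ultimately show "\<exists>U. delta_cover \<delta> A U \<and> (\<Sum>i. diam_pow s (U i)) < ennreal \<epsilon>" by blast
  qed
qed

lemma hausdorff_measure_eq_0_subset:
  assumes "hausdorff_measure s B = 0" "A \<subseteq> B"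
  shows "hausdorff_measure s A = 0"
  unfolding hausdorff_measure_eq_0_iff
proof (intro allI impI)
  fix \<delta> \<epsilon> :: real assume "\<delta> > 0" "\<epsilon> > 0"
  then obtain U where "delta_cover \<delta> B U" "(\<Sum>i. diam_pow s (U i)) < ennreal \<epsilon>"
    using assms(1) unfolding hausdorff_measure_eq_0_iff by metis
  then show "\<exists>U. delta_cover \<delta> A U \<and> (\<Sum>i. diam_pow s (U i)) < ennreal \<epsilon>"
    using assms(2) by (intro exI[of _ U]) (auto simp: delta_cover_def)
qed

section \<open>Packing measures on the real line\<close>

lemma infsum_ennreal_leI:
  fixes f :: "'a \<Rightarrow> ennreal"
  assumes "\<And>F. finite F \<Longrightarrow> F \<subseteq> P \<Longrightarrow> sum f F \<le> b"
  shows "infsum f P \<le> b"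
  using assms by (subst nonneg_infsum_complete) (auto intro!: SUP_least)

text \<open>
  Points of \<open>E\<close> in cells whose indices differ by at least two are more than \<open>\<delta>\<close> apart, so cells of
  one parity yield a packing.
\<close>

lemma card_cells_le_packing_premeasure_delta:
  fixes E :: "real set" and K :: "int set"
  assumes \<delta>: "0 < \<delta>" and K: "finite K"
    and parity: "\<And>k l. k \<in> K \<Longrightarrow> l \<in> K \<Longrightarrow> even (k - l)"
    and hit: "\<And>k. k \<in> K \<Longrightarrow> E \<inter> {of_int k * \<delta>..<(of_int k + 1) * \<delta>} \<noteq> {}"
  shows "of_nat (card K) * ennreal (\<delta> powr s) \<le> packing_premeasure_delta s (\<delta> / 2) E"
proof -
  have "\<forall>k\<in>K. \<exists>x. x \<in> E \<inter> {of_int k * \<delta>..<(of_int k + 1) * \<delta>}" using hit by blast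
  then obtain x where x: "\<And>k. k \<in> K \<Longrightarrow> x k \<in> E \<inter> {of_int k * \<delta>..<(of_int k + 1) * \<delta>}" by metis
  \<comment> \<open>Half-open cells make the gap strict, so the closed balls of radius
    \<open>\<delta> / 2\<close> do not even touch.\<close>
  have sep: "\<delta> < x l - x k" if "k \<in> K" "l \<in> K" "k < l" for k l
  proof -
    have "k + 2 \<le> l" using parity[OF that(2,1)] that(3) by presburger
    then have "(real_of_int k + 2) * \<delta> \<le> of_int l * \<delta>"
      using \<delta> by (intro mult_right_mono) linarith+
    then show ?thesis using x[OF that(1)] x[OF that(2)] by (auto simp: algebra_simps)
  qed
  then have sep': "\<delta> < \<bar>x l - x k\<bar>" if "k \<in> K" "l \<in> K" "k \<noteq> l" for k l
    using that sep[of k l] sep[of l k] by linarith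
  define P where "P = (\<lambda>k. (x k, \<delta> / 2)) ` K"
  have inj: "inj_on (\<lambda>k. (x k, \<delta> / 2)) K"
    using sep' \<delta> by (fastforce simp: inj_on_def)
  have "delta_packing (\<delta> / 2) E P"
    unfolding delta_packing_def
  proof (intro conjI)
    show "countable P" using K by (auto simp: P_def intro: countable_finite)
    show "\<forall>(y, r)\<in>P. y \<in> E \<and> 0 < r \<and> r \<le> \<delta> / 2" using x \<delta> by (auto simp: P_def)
    show "disjoint_family_on (\<lambda>(x, r). cball x r) P"
    proof (clarsimp simp: disjoint_family_on_def P_def)
      fix k l assume kl: "k \<in> K" "l \<in> K" "x k \<noteq> x l"
      then have "\<delta> < \<bar>x l - x k\<bar>" using sep' by auto
      then show "cball (x k) (\<delta>/2) \<inter> cball (x l) (\<delta>/2) = {}"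
        by (auto simp: cball_eq_atLeastAtMost)
    qed
  qed
  then have "(\<Sum>\<^sub>\<infinity>(y, r)\<in>P. ennreal ((2 * r) powr s)) \<le> packing_premeasure_delta s (\<delta> / 2) E"
    unfolding packing_premeasure_delta_def by (intro SUP_upper) auto
  moreover have "(\<Sum>\<^sub>\<infinity>(y, r)\<in>P. ennreal ((2 * r) powr s)) = (\<Sum>(y, r)\<in>P. ennreal ((2 * r) powr s))"
    using K by (intro infsum_finite) (auto simp: P_def)
  moreover have "\<dots> = of_nat (card K) * ennreal (\<delta> powr s)"
    unfolding P_def by (subst sum.reindex[OF inj]) simp
  ultimately show ?thesis by simp
qed

text \<open>Cutting \<open>E\<close> along the grid of mesh \<delta> yields a cover whose nonempty
  pieces cost at most \<open>\<delta> powr s\<close> each. The nonempty cells of one parity carry a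
  packing whose balls have exactly this cost, so each parity is bounded by the premeasure; hence the
  factor 2.\<close>

lemma hausdorff_measure_delta_le_packing_premeasure_delta:
  fixes E :: "real set"
  assumes \<delta>: "0 < \<delta>" and s: "0 \<le> s"
  shows "hausdorff_measure_delta s \<delta> E \<le> 2 * packing_premeasure_delta s (\<delta> / 2) E"
proof -
  let ?J = "\<lambda>k::int. {of_int k * \<delta>..<(of_int k + 1) * \<delta>}"
  let ?P = "packing_premeasure_delta s (\<delta> / 2) E"
  define U where "U n = E \<inter> ?J (int_decode n)" for n
  have diam: "bounded (U n)" "diameter (U n) \<le> \<delta>" for n
  proof -
    show b: "bounded (U n)" by (rule bounded_subset[of "?J (int_decode n)"]) (auto simp: U_def)
    have "dist a b \<le> \<delta>" if "a \<in> U n" "b \<in> U n" for a b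
      using that by (auto simp: U_def dist_real_def algebra_simps)
    then show "diameter (U n) \<le> \<delta>" 
      using \<delta> by (auto simp: diameter_def intro!: cSUP_least)
  qed
  have "E \<subseteq> (\<Union>n. U n)"
  proof
    fix y assume "y \<in> E"
    moreover have "y \<in> ?J \<lfloor>y / \<delta>\<rfloor>"
      using \<delta> by (auto simp: pos_divide_less_eq[symmetric] pos_le_divide_eq[symmetric])
    ultimately have "y \<in> U (int_encode \<lfloor>y / \<delta>\<rfloor>)" by (simp add: U_def)
    then show "y \<in> (\<Union>n. U n)" by blast
  qed
  with diam have "delta_cover \<delta> E U" by (auto simp: delta_cover_def)
  then have "hausdorff_measure_delta s \<delta> E \<le> (\<Sum>n. diam_pow s (U n))"
    unfolding hausdorff_measure_delta_def by (intro INF_lower) auto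
  also have "\<dots> \<le> 2 * ?P"
  proof (rule suminf_le_const)
    fix n
    have half: "(\<Sum>i\<in>{i\<in>{..<n}. U i \<noteq> {} \<and> Q (int_decode i)}. ennreal (\<delta> powr s)) \<le> ?P"
      if Q: "\<And>k l. Q k \<Longrightarrow> Q l \<Longrightarrow> even (k - l)" for Q
    proof -
      let ?I = "{i\<in>{..<n}. U i \<noteq> {} \<and> Q (int_decode i)}"
      have "of_nat (card (int_decode ` ?I)) * ennreal (\<delta> powr s) \<le> ?P"
        using \<delta> Q by (intro card_cells_le_packing_premeasure_delta) (auto simp: U_def)
      moreover have "card (int_decode ` ?I) = card ?I"
        by (intro card_image inj_int_decode)
      ultimately show ?thesis by simp
    qed
    have "(\<Sum>i<n. diam_pow s (U i)) \<le> (\<Sum>i<n. if U i = {} then 0 else ennreal (\<delta> powr s))"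
    proof (rule sum_mono)
      fix i
      have "0 \<le> diameter (U i)" using diam by (simp add: diameter_ge_0)
      then show "diam_pow s (U i) \<le> (if U i = {} then 0 else ennreal (\<delta> powr s))"
        using diam[of i] s \<delta> by (auto simp: diam_pow_def intro!: ennreal_leI powr_mono2)
    qed
    also have "\<dots> = (\<Sum>i\<in>{i\<in>{..<n}. U i \<noteq> {}}. ennreal (\<delta> powr s))"
      by (subst sum.inter_filter) (auto intro!: sum.cong)
    also have "{i\<in>{..<n}. U i \<noteq> {}} = {i\<in>{..<n}. U i \<noteq> {} \<and> even (int_decode i)} \<union>
        {i\<in>{..<n}. U i \<noteq> {} \<and> odd (int_decode i)}" by auto
    also have "(\<Sum>i\<in>\<dots>. ennreal (\<delta> powr s)) =
      (\<Sum>i\<in>{i\<in>{..<n}. U i \<noteq> {} \<and> even (int_decode i)}. ennreal (\<delta> powr s)) +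
      (\<Sum>i\<in>{i\<in>{..<n}. U i \<noteq> {} \<and> odd (int_decode i)}. ennreal (\<delta> powr s))"
      by (intro sum.union_disjoint) auto
    also have "\<dots> \<le> ?P + ?P"
      by (intro add_mono half) auto
    finally show "(\<Sum>i<n. diam_pow s (U i)) \<le> 2 * ?P" by (simp add: mult_2)
  qed auto
  finally show ?thesis .
qed

lemma hausdorff_measure_delta_antimono:
  "\<delta> \<le> \<delta>' \<Longrightarrow> hausdorff_measure_delta s \<delta>' A \<le> hausdorff_measure_delta s \<delta> A"
  unfolding hausdorff_measure_delta_def delta_cover_def
  by (rule INF_superset_mono) (blast intro: order_trans)+

lemma packing_premeasure_delta_mono:
  "\<delta> \<le> \<delta>' \<Longrightarrow> packing_premeasure_delta s \<delta> A \<le> packing_premeasure_delta s \<delta>' A"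
  unfolding packing_premeasure_delta_def
  by (intro SUP_subset_mono) (force simp: delta_packing_def)+

lemma hausdorff_measure_delta_le_packing_premeasure:
  fixes E :: "real set"
  assumes "0 < \<delta>" "0 \<le> s"
  shows "hausdorff_measure_delta s \<delta> E \<le> 2 * packing_premeasure s E"
proof -
  have "hausdorff_measure_delta s \<delta> E \<le> 2 * packing_premeasure_delta s \<eta> E" if "\<eta> > 0" for \<eta>
  proof -
    \<comment> \<open>A common scale: Hausdorff premeasures can only grow when the mesh shrinks, and
      radii are half the mesh, so \<open>\<theta> / 2\<close> stays below \<eta>.\<close>
    define \<theta> where "\<theta> = min \<delta> (2 * \<eta>)"
    have "hausdorff_measure_delta s \<delta> E \<le> hausdorff_measure_delta s \<theta> E"
      by (intro hausdorff_measure_delta_antimono) (simp add: \<theta>_def)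
    also have "\<dots> \<le> 2 * packing_premeasure_delta s (\<theta> / 2) E"
      using assms that by (intro hausdorff_measure_delta_le_packing_premeasure_delta) (auto simp: \<theta>_def)
    also have "\<dots> \<le> 2 * packing_premeasure_delta s \<eta> E"
      by (intro mult_left_mono packing_premeasure_delta_mono) (auto simp: \<theta>_def)
    finally show ?thesis .
  qed
  then have "hausdorff_measure_delta s \<delta> E / 2 \<le> packing_premeasure s E"
    unfolding packing_premeasure_def
    by (intro INF_greatest divide_le_posI_ennreal) auto
  from mult_left_mono[OF this, of 2] show ?thesis
    by (simp add: ennreal_times_divide mult.commute[of 2] mult_divide_eq_ennreal)
qed

text \<open>The packing measure decomposes \<open>A\<close> into countably many pieces before taking
  premeasures. Hausdorff covers of the pieces, each controlled by its premeasure up to errors adding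
  up to \<open>\<epsilon>/2\<close>, merge into one cover of \<open>A\<close>.\<close>

lemma packing_measure_eq_0_imp_hausdorff_measure_eq_0:
  fixes A :: "real set"
  assumes "packing_measure s A = 0" "0 \<le> s"
  shows "hausdorff_measure s A = 0"
  unfolding hausdorff_measure_eq_0_iff
proof (intro allI impI)
  fix \<delta> \<epsilon> :: real assume \<delta>: "\<delta> > 0" and \<epsilon>: "\<epsilon> > 0"
  have "packing_measure s A < ennreal (\<epsilon>/4)" using assms \<epsilon> by simp
  then obtain E :: "nat \<Rightarrow> real set" where E: "A \<subseteq> (\<Union>i. E i)"
    "(\<Sum>i. packing_premeasure s (E i)) < ennreal (\<epsilon>/4)"
    unfolding packing_measure_def INF_less_iff by auto
  have "\<exists>U. delta_cover \<delta> (E i) U \<and>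
    (\<Sum>j. diam_pow s (U j)) \<le> 2 * packing_premeasure s (E i) + ennreal (\<epsilon>/2 * (1/2)^Suc i)" for i
  proof -
    \<comment> \<open>Finiteness turns adding a positive error into a strict increase, which allows
      a cover to be picked from the infimum.\<close>
    have "packing_premeasure s (E i) < top"
      using ennreal_suminf_lessD[OF E(2)] by (rule less_trans) simp
    then have "2 * packing_premeasure s (E i) < top" by (simp add: ennreal_mult_less_top)
    then have "2 * packing_premeasure s (E i) <
        2 * packing_premeasure s (E i) + ennreal (\<epsilon>/2 * (1/2)^Suc i)" (is "_ < ?b")
      using \<epsilon> by (simp del: power_Suc add: less_top)
    then have "hausdorff_measure_delta s \<delta> (E i) < ?b"
      using hausdorff_measure_delta_le_packing_premeasure[OF \<delta> assms(2)] by (rule le_less_trans[rotated])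
    then show ?thesis unfolding hausdorff_measure_delta_def INF_less_iff by (auto intro: less_imp_le)
  qed
  then obtain U where U: "\<And>i. delta_cover \<delta> (E i) (U i)"
    "\<And>i. (\<Sum>j. diam_pow s (U i j)) \<le> 2 * packing_premeasure s (E i) + ennreal (\<epsilon>/2 * (1/2)^Suc i)"
    by metis
  define V where "V n = (case prod_decode n of (i, j) \<Rightarrow> U i j)" for n
  have "delta_cover \<delta> A V"
    unfolding delta_cover_def
  proof (intro conjI allI subsetI)
    fix x assume "x \<in> A"
    then obtain i j where "x \<in> U i j" using E(1) U(1) unfolding delta_cover_def by blast
    then have "x \<in> V (prod_encode (i, j))" by (simp add: V_def)
    then show "x \<in> (\<Union>n. V n)" by blast
  next
    fix n
    obtain i j where "prod_decode n = (i, j)" by fastforce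
    then show "bounded (V n)" "diameter (V n) \<le> \<delta>" using U(1)[of i] by (auto simp: V_def delta_cover_def)
  qed
  moreover have "(\<Sum>n. diam_pow s (V n)) < ennreal \<epsilon>"
  proof -
    have "(\<Sum>n. diam_pow s (V n)) = (\<Sum>n. (\<lambda>(i, j). diam_pow s (U i j)) (prod_decode n))"
      by (simp add: V_def case_prod_beta)
    also have "\<dots> = (\<Sum>i. \<Sum>j. diam_pow s (U i j))"
      by (rule suminf_ennreal_2dimen) simp
    also have "\<dots> \<le> (\<Sum>i. 2 * packing_premeasure s (E i) + ennreal (\<epsilon>/2 * (1/2)^Suc i))"
      using U by (intro suminf_le) auto
    also have "\<dots> = 2 * (\<Sum>i. packing_premeasure s (E i)) + (\<Sum>i. ennreal (\<epsilon>/2 * (1/2)^Suc i))"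
      by (subst suminf_add[symmetric]) auto
    also have "(\<Sum>i. ennreal (\<epsilon>/2 * (1/2)^Suc i)) = ennreal (\<epsilon>/2)"
      using \<epsilon> by (intro suminf_ennreal_half_powers) auto
    also have "2 * (\<Sum>i. packing_premeasure s (E i)) + ennreal (\<epsilon>/2) < 2 * ennreal (\<epsilon>/4) + ennreal (\<epsilon>/2)"
      using ennreal_mult_strict_left_mono[OF E(2), of 2]
      by (simp add: ennreal_add_left_cancel_less add.commute)
    also have "2 * ennreal (\<epsilon>/4) + ennreal (\<epsilon>/2) = ennreal \<epsilon>"
      using \<epsilon> by (simp flip: ennreal_plus ennreal_mult ennreal_numeral)
    finally show ?thesis .
  qed
  ultimately show "\<exists>U. delta_cover \<delta> A U \<and> (\<Sum>i. diam_pow s (U i)) < ennreal \<epsilon>" by blast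
qed

section \<open>The upper bound 1 for the packing dimension on the line\<close>

lemma sum_radii_delta_packing_le:
  assumes P: "delta_packing \<delta> {a..b::real} P" and "finite P" and "0 < \<delta>" "a \<le> b"
  shows "(\<Sum>(x, r)\<in>P. ennreal (2 * r)) \<le> ennreal (b - a + 2 * \<delta>)"
proof -
  have P': "x \<in> {a..b}" "0 < r" "r \<le> \<delta>" if "(x, r) \<in> P" for x r
    using P that by (auto simp: delta_packing_def)
  have "(\<Sum>(x, r)\<in>P. ennreal (2 * r)) = (\<Sum>p\<in>P. emeasure lborel ((\<lambda>(x, r). cball x r) p))"
    using P' by (intro sum.cong) (force simp: cball_eq_atLeastAtMost)+
  also have "\<dots> = emeasure lborel (\<Union>p\<in>P. (\<lambda>(x, r). cball x r) p)"
    using assms by (intro sum_emeasure) (auto simp: delta_packing_def)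
  also have "\<dots> \<le> emeasure lborel {a - \<delta>..b + \<delta>}"
    using P' by (intro emeasure_mono) (fastforce simp: cball_eq_atLeastAtMost)+
  also have "\<dots> = ennreal (b - a + 2 * \<delta>)"
    using assms by simp
  finally show ?thesis .
qed

text \<open>The disjoint balls of a packing lie in the \<delta>-neighbourhood of the interval, so
  their total length is bounded. Each term is at most the length of its ball times
  \<open>(2 * \<delta>) powr (s - 1)\<close>, and this factor tends to 0 with \<delta>.\<close>

lemma packing_premeasure_interval_eq_0:
  assumes s: "1 < s" and ab: "a \<le> (b::real)"
  shows "packing_premeasure s {a..b} = 0"
proof -
  have le: "packing_premeasure s {a..b} \<le> ennreal ((2 * \<delta>) powr (s - 1) * (b - a + 2 * \<delta>))"
    if \<delta>: "0 < \<delta>" for \<delta>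
  proof -
    have "packing_premeasure s {a..b} \<le> packing_premeasure_delta s \<delta> {a..b}"
      unfolding packing_premeasure_def using \<delta> by (intro INF_lower) auto
    also have "\<dots> \<le> ennreal ((2 * \<delta>) powr (s - 1) * (b - a + 2 * \<delta>))"
      unfolding packing_premeasure_delta_def
    proof (intro SUP_least infsum_ennreal_leI)
      fix P F assume "P \<in> {P. delta_packing \<delta> {a..b} P}" and F: "finite F" "F \<subseteq> P"
      then have pF: "delta_packing \<delta> {a..b} F"
        unfolding delta_packing_def
        by (auto intro: countable_subset disjoint_family_on_mono)
      have "(\<Sum>(x, r)\<in>F. ennreal ((2 * r) powr s)) \<le> (\<Sum>(x, r)\<in>F. ennreal ((2 * \<delta>) powr (s - 1)) * ennreal (2 * r))"
      proof (rule sum_mono, clarify)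
        fix x r assume "(x, r) \<in> F"
        then have r: "0 < r" "r \<le> \<delta>" using pF by (auto simp: delta_packing_def)
        have "(2 * r) powr s = (2 * r) powr (s - 1) * (2 * r) powr 1"
          using r by (subst powr_add[symmetric]) simp
        also have "\<dots> \<le> (2 * \<delta>) powr (s - 1) * (2 * r)"
          using r s by (intro mult_mono powr_mono2) auto
        finally show "ennreal ((2 * r) powr s) \<le> ennreal ((2 * \<delta>) powr (s - 1)) * ennreal (2 * r)"
          using r by (simp add: ennreal_leI flip: ennreal_mult)
      qed
      also have "\<dots> = ennreal ((2 * \<delta>) powr (s - 1)) * (\<Sum>(x, r)\<in>F. ennreal (2 * r))"
        by (simp add: sum_distrib_left case_prod_beta)
      also have "\<dots> \<le> ennreal ((2 * \<delta>) powr (s - 1)) * ennreal (b - a + 2 * \<delta>)"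
        using F pF \<delta> ab by (intro mult_left_mono sum_radii_delta_packing_le) auto
      finally show "(\<Sum>(x, r)\<in>F. ennreal ((2 * r) powr s)) \<le> ennreal ((2 * \<delta>) powr (s - 1) * (b - a + 2 * \<delta>))"
        using \<delta> ab by (simp add: ennreal_mult)
    qed
    finally show ?thesis .
  qed
  have "((\<lambda>\<delta>. (2 * \<delta>) powr (s - 1) * (b - a + 2 * \<delta>)) \<longlongrightarrow> 0 * (b - a + 2 * 0)) (at_right 0)"
  proof (intro tendsto_intros)
    have "((\<lambda>\<delta>. (2 * \<delta>) powr (s - 1)) \<longlongrightarrow> (2 * 0) powr (s - 1)) (at_right 0)"
      using s by (intro tendsto_powr' tendsto_intros) (auto simp: eventually_at_filter)
    then show "((\<lambda>\<delta>. (2 * \<delta>) powr (s - 1)) \<longlongrightarrow> 0) (at_right 0)" by simp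
  qed
  then have "((\<lambda>\<delta>. ennreal ((2 * \<delta>) powr (s - 1) * (b - a + 2 * \<delta>))) \<longlongrightarrow> ennreal 0) (at_right 0)"
    by (intro tendsto_ennrealI) simp
  then have "packing_premeasure s {a..b} \<le> ennreal 0"
    by (rule tendsto_lowerbound) (use le in \<open>auto simp: eventually_at_filter\<close>)
  then show ?thesis by simp
qed

lemma packing_measure_real_eq_0:
  fixes A :: "real set"
  assumes "1 < s"
  shows "packing_measure s A = 0"
proof -
  have "A \<subseteq> (\<Union>i. {- real i..real i})"
  proof
    fix x :: real
    obtain n where "\<bar>x\<bar> \<le> real n" using real_arch_simple by blast
    then show "x \<in> (\<Union>i. {- real i..real i})" by (intro UN_I[of n]) auto
  qed
  then have "packing_measure s A \<le> (\<Sum>i. packing_premeasure s {- real i..real i})"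
    unfolding packing_measure_def by (intro INF_lower) auto
  also have "\<dots> = 0" using assms by (simp add: packing_premeasure_interval_eq_0)
  finally show ?thesis by simp
qed

lemma packing_dim_real_le_1: "packing_dim (A :: real set) \<le> 1"
proof (rule ennreal_le_epsilon)
  fix e :: real assume e: "0 < e"
  have "packing_dim A \<le> ennreal (1 + e)"
    unfolding packing_dim_def using e
    by (intro Inf_lower CollectI exI[of _ "1 + e"]) (simp add: packing_measure_real_eq_0)
  then show "packing_dim A \<le> 1 + ennreal e" using e by (simp add: ennreal_plus)
qed

lemma hausdorff_dim_le_packing_dim: "hausdorff_dim (A :: real set) \<le> packing_dim A"
  unfolding hausdorff_dim_def packing_dim_def
  by (intro Inf_superset_mono) (auto intro: packing_measure_eq_0_imp_hausdorff_measure_eq_0)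

text \<open>By monotonicity in the exponent, a sequence of exponents tending to 1 tests whether the
  Hausdorff dimension is at least 1; the packing dimension is squeezed between it and 1. Countably
  many conditions can be intersected, both as Borel sets and almost everywhere. The shift by 2 keeps
  every exponent strictly between 0 and 1.\<close>

lemma hausdorff_packing_dim_real_eq_1_iff:
  fixes A :: "real set"
  shows "hausdorff_dim A = 1 \<and> packing_dim A = 1 \<longleftrightarrow>
    (\<forall>n. hausdorff_measure (1 - 1 / real (n + 2)) A \<noteq> 0)"
proof
  assume R: "\<forall>n. hausdorff_measure (1 - 1 / real (n + 2)) A \<noteq> 0"
  have "1 \<le> s" if s: "0 \<le> s" "hausdorff_measure s A = 0" for s
  proof (rule ccontr)
    assume "\<not> 1 \<le> s"
    then obtain n where "inverse (real (Suc n)) < 1 - s" using reals_Archimedean[of "1 - s"] by auto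
    moreover have "1 / real (n + 2) \<le> inverse (real (Suc n))" by (simp add: field_simps)
    ultimately have "s \<le> 1 - 1 / real (n + 2)" by linarith
    then show False using R hausdorff_measure_eq_0_mono[OF s(2,1)] by blast
  qed
  then have "1 \<le> hausdorff_dim A"
    unfolding hausdorff_dim_def by (intro Inf_greatest) auto
  then show "hausdorff_dim A = 1 \<and> packing_dim A = 1"
    using hausdorff_dim_le_packing_dim[of A] packing_dim_real_le_1[of A] by (auto intro: antisym)
next
  assume L: "hausdorff_dim A = 1 \<and> packing_dim A = 1"
  show "\<forall>n. hausdorff_measure (1 - 1 / real (n + 2)) A \<noteq> 0"
  proof (intro allI notI)
    fix n assume "hausdorff_measure (1 - 1 / real (n + 2)) A = 0"
    then have "hausdorff_dim A \<le> ennreal (1 - 1 / real (n + 2))"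
      unfolding hausdorff_dim_def by (intro Inf_lower) (auto simp: field_simps)
    also have "\<dots> < 1" by (subst ennreal_1[symmetric], subst ennreal_less_iff) (auto simp: field_simps)
    finally show False using L by simp
  qed
qed

section \<open>Borel measurability\<close>

text \<open>A compact range has a uniform neighbourhood inside \<open>V\<close>, and a perturbation
  that is small in the supremum distance stays in it.\<close>

lemma open_bcontfun_range_subset:
  fixes V :: "'b::metric_space set"
  assumes "compact (UNIV :: 'a::metric_space set)" "open V"
  shows "open {f :: 'a \<Rightarrow>\<^sub>C 'b. range (apply_bcontfun f) \<subseteq> V}"
  unfolding open_dist
proof (intro ballI)
  fix f :: "'a \<Rightarrow>\<^sub>C 'b" assume f: "f \<in> {f. range (apply_bcontfun f) \<subseteq> V}"
  have "compact (range (apply_bcontfun f))"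
    using assms by (intro compact_continuous_image) auto
  with f assms(2) obtain e where e: "0 < e" "(\<Union>y\<in>range (apply_bcontfun f). ball y e) \<subseteq> V"
    by (auto elim: compact_subset_open_imp_ball_epsilon_subset)
  have "range (apply_bcontfun g) \<subseteq> V" if "dist g f < e" for g
  proof safe
    fix x
    have "apply_bcontfun g x \<in> ball (apply_bcontfun f x) e"
      using le_less_trans[OF dist_bounded that] by (simp add: dist_commute)
    with e show "apply_bcontfun g x \<in> V" by blast
  qed
  with e(1) show "\<exists>e>0. \<forall>g. dist g f < e \<longrightarrow> g \<in> {f. range (apply_bcontfun f) \<subseteq> V}" by blast
qed

text \<open>Null sets are detected by open covers, so the functions with null range form a \<open>G\<^sub>\<delta>\<close> set.\<close>

lemma borel_hausdorff_measure_range_eq_0: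
  assumes X: "compact (UNIV :: 'a::metric_space set)" and s: "0 < s"
  shows "{f :: 'a \<Rightarrow>\<^sub>C 'b::metric_space. hausdorff_measure s (range (apply_bcontfun f)) = 0} \<in> sets borel"
proof -
  define \<V> where "\<V> n = {V :: nat \<Rightarrow> 'b set. (\<forall>i. open (V i) \<and> bounded (V i)) \<and>
    (\<Sum>i. diam_pow s (V i)) < ennreal (1 / real (Suc n))}" for n
  have "{f :: 'a \<Rightarrow>\<^sub>C 'b. hausdorff_measure s (range (apply_bcontfun f)) = 0} =
    (\<Inter>n. \<Union>V\<in>\<V> n. {f. range (apply_bcontfun f) \<subseteq> (\<Union>i. V i)})" (is "?L = ?R")
  proof (intro set_eqI iffI)
    fix f assume "f \<in> ?L"
    then have f: "hausdorff_measure s (range (apply_bcontfun f)) = 0" by simp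
    have "\<exists>V\<in>\<V> n. range (apply_bcontfun f) \<subseteq> (\<Union>i. V i)" for n
      using f[unfolded hausdorff_measure_eq_0_open_cover_iff[OF s], rule_format, of "1 / real (Suc n)"]
      unfolding \<V>_def by auto
    then show "f \<in> ?R" by simp
  next
    fix f assume f: "f \<in> ?R"
    show "f \<in> ?L"
      unfolding mem_Collect_eq hausdorff_measure_eq_0_open_cover_iff[OF s]
    proof (intro allI impI)
      fix \<epsilon> :: real assume "\<epsilon> > 0"
      then obtain n where n: "1 / real (Suc n) < \<epsilon>" using nat_approx_posE by blast
      from f obtain V where V: "V \<in> \<V> n" "range (apply_bcontfun f) \<subseteq> (\<Union>i. V i)" by blast
      moreover have "(\<Sum>i. diam_pow s (V i)) < ennreal \<epsilon>"
      proof (rule less_le_trans)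
        show "(\<Sum>i. diam_pow s (V i)) < ennreal (1 / real (Suc n))" using V(1) by (simp add: \<V>_def)
        show "ennreal (1 / real (Suc n)) \<le> ennreal \<epsilon>" using n by (intro ennreal_leI) simp
      qed
      ultimately show "\<exists>V. (\<forall>i. open (V i) \<and> bounded (V i)) \<and> range (apply_bcontfun f) \<subseteq> (\<Union>i. V i) \<and>
          (\<Sum>i. diam_pow s (V i)) < ennreal \<epsilon>"
        unfolding \<V>_def by blast
    qed
  qed
  \<comment> \<open>The union over the covers in \<open>\<V> n\<close> may be uncountable, but it is
    a union of open sets; only the intersection over \<open>n\<close> must be countable.\<close>
  also have "\<dots> \<in> sets borel"
    by (intro sets.countable_INT'' borel_open open_UN ballI open_bcontfun_range_subset[OF X])
       (auto simp: \<V>_def)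
  finally show ?thesis .
qed

section \<open>A continuous function with a Borel section\<close>

text \<open>If every point had a ball meeting \<open>T\<close> in a countable set, finitely many
  such balls would cover \<open>T\<close>.\<close>

lemma compact_uncountable_condensation_point:
  fixes T :: "'a::metric_space set"
  assumes "compact T" "uncountable T"
  obtains x where "x \<in> T" "\<And>r. 0 < r \<Longrightarrow> uncountable (T \<inter> cball x r)"
proof (rule ccontr)
  assume "\<not> thesis"
  then have "\<forall>x\<in>T. \<exists>r>0. countable (T \<inter> cball x r)" using that by blast
  then obtain r where r: "\<And>x. x \<in> T \<Longrightarrow> 0 < r x" "\<And>x. x \<in> T \<Longrightarrow> countable (T \<inter> cball x (r x))"
    by metis
  obtain D where D: "D \<subseteq> T" "finite D" "T \<subseteq> (\<Union>x\<in>D. ball x (r x))"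
    by (rule compactE_image[OF \<open>compact T\<close>, of T "\<lambda>x. ball x (r x)"]) (use r in force)+
  have "T \<subseteq> (\<Union>x\<in>D. T \<inter> cball x (r x))"
    using D(3) ball_subset_cball by blast
  moreover have "countable (\<Union>x\<in>D. T \<inter> cball x (r x))"
    using D r(2) by (intro countable_UN[OF countable_finite]) auto
  ultimately show False using assms countable_subset by blast
qed

text \<open>Small closed balls around two distinct condensation points of \<open>S\<close> cut out
  the two pieces.\<close>

lemma compact_uncountable_split:
  fixes S :: "'a::metric_space set"
  assumes S: "compact S" "uncountable S" and e: "0 < e"
  obtains A B where "compact A" "compact B" "uncountable A" "uncountable B" "A \<subseteq> S" "B \<subseteq> S"
    "A \<inter> B = {}" "\<exists>x. A \<subseteq> cball x e" "\<exists>x. B \<subseteq> cball x e"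
proof -
  obtain x where x: "x \<in> S" "\<And>r. 0 < r \<Longrightarrow> uncountable (S \<inter> cball x r)"
    using compact_uncountable_condensation_point[OF S] by blast
  \<comment> \<open>These remainders exhaust \<open>S\<close> without \<open>x\<close>, so one of
    them is uncountable; being compact, it has a condensation point of its own, away from
    \<open>x\<close>.\<close>
  have "\<exists>n. uncountable (S - ball x (1 / real (Suc n)))"
  proof (rule ccontr)
    assume "\<nexists>n. uncountable (S - ball x (1 / real (Suc n)))"
    then have "countable (insert x (\<Union>n. S - ball x (1 / real (Suc n))))"
      by (intro countable_insert countable_UN) auto
    moreover have "S \<subseteq> insert x (\<Union>n. S - ball x (1 / real (Suc n)))"
    proof
      fix y assume y: "y \<in> S"
      show "y \<in> insert x (\<Union>n. S - ball x (1 / real (Suc n)))"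
      proof (cases "y = x")
        case False
        then obtain n where "1 / real (Suc n) < dist x y"
          using nat_approx_posE[of "dist x y"] by auto
        with y show ?thesis by (intro insertI2 UN_I[of n]) auto
      qed auto
    qed
    ultimately show False using S countable_subset by blast
  qed
  then obtain n where n: "uncountable (S - ball x (1 / real (Suc n)))" by blast
  define r where "r = 1 / real (Suc n)"
  have r: "0 < r" by (simp add: r_def)
  have "compact (S - ball x r)" using S by (simp add: compact_diff)
  then obtain y where y: "y \<in> S - ball x r" "\<And>\<rho>. 0 < \<rho> \<Longrightarrow> uncountable ((S - ball x r) \<inter> cball y \<rho>)"
    using compact_uncountable_condensation_point n unfolding r_def by blast
  \<comment> \<open>The centres are at distance at least \<open>r\<close>, so radii of at most
    \<open>r / 3\<close> keep the balls disjoint.\<close>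
  define \<rho> where "\<rho> = min e (r / 3)"
  have \<rho>: "0 < \<rho>" "\<rho> \<le> e" "\<rho> \<le> r / 3" using e r by (auto simp: \<rho>_def)
  show ?thesis
  proof (rule that)
    show "compact (S \<inter> cball x \<rho>)" "compact (S \<inter> cball y \<rho>)"
      using S by (auto intro: compact_Int_closed)
    show "uncountable (S \<inter> cball x \<rho>)" using x \<rho> by blast
    show "uncountable (S \<inter> cball y \<rho>)"
      using y(2)[OF \<rho>(1)] by (rule contrapos_nn) (auto elim: countable_subset[rotated])
    show "(S \<inter> cball x \<rho>) \<inter> (S \<inter> cball y \<rho>) = {}"
    proof -
      have "False" if "z \<in> cball x \<rho>" "z \<in> cball y \<rho>" for z
        using that y(1) \<rho> r dist_triangle2[of x y z] by (auto simp: not_less)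
      then show ?thesis by blast
    qed
    show "\<exists>z. S \<inter> cball x \<rho> \<subseteq> cball z e" using \<rho> by (intro exI[of _ x]) auto
    show "\<exists>z. S \<inter> cball y \<rho> \<subseteq> cball z e" using \<rho> by (intro exI[of _ y]) auto
  qed auto
qed

text \<open>Level \<open>n\<close> is addressed by \<open>n\<close> binary digits:
  \<open>k div 2\<close> is the parent of \<open>k\<close>, and the last digit of \<open>k\<close>
  selects the half. Disjointness needs the bound \<open>2 ^ n\<close> on the addresses, because at
  level 0 every index carries the whole space.\<close>

lemma cantor_scheme:
  assumes X: "compact (UNIV :: 'a::metric_space set)" "uncountable (UNIV :: 'a::metric_space set)"
  obtains K :: "nat \<Rightarrow> nat \<Rightarrow> 'a::metric_space set" where
    "\<And>n k. compact (K n k)" "\<And>n k. K n k \<noteq> {}" "\<And>n k. K (Suc n) k \<subseteq> K n (k div 2)"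
    "\<And>n k l. k < 2 ^ n \<Longrightarrow> l < 2 ^ n \<Longrightarrow> k \<noteq> l \<Longrightarrow> K n k \<inter> K n l = {}"
    "\<And>n k. \<exists>x. K (Suc n) k \<subseteq> cball x (1 / real (Suc n))"
proof -
  have "\<forall>e S. \<exists>A B. compact S \<and> uncountable S \<and> 0 < e \<longrightarrow> compact A \<and> compact B \<and>
    uncountable A \<and> uncountable B \<and> A \<subseteq> S \<and> B \<subseteq> S \<and>
    A \<inter> B = {} \<and> (\<exists>x. A \<subseteq> cball x e) \<and> (\<exists>x::'a. B \<subseteq> cball x e)"
    by (metis compact_uncountable_split)
  then obtain L R where LR: "\<And>e S. compact S \<Longrightarrow> uncountable S \<Longrightarrow> 0 < e \<Longrightarrow>
    compact (L e S) \<and> compact (R e S) \<and>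
    uncountable (L e S) \<and> uncountable (R e S) \<and> L e S \<subseteq> S \<and> R e S \<subseteq> S \<and>
    L e S \<inter> R e S = {} \<and> (\<exists>x. L e S \<subseteq> cball x e) \<and> (\<exists>x::'a. R e S \<subseteq> cball x e)"
    by metis
  define K :: "nat \<Rightarrow> nat \<Rightarrow> 'a set" where "K = rec_nat (\<lambda>_. UNIV) (\<lambda>n Kn k.
    (if even k then L else R) (1 / real (Suc n)) (Kn (k div 2)))"
  have K0: "K 0 k = UNIV" for k by (simp add: K_def)
  have KS: "K (Suc n) k = (if even k then L else R) (1 / real (Suc n)) (K n (k div 2))" for n k
    by (simp add: K_def)
  have K: "compact (K n k) \<and> uncountable (K n k)" for n k
  proof (induction n arbitrary: k)
    case (Suc n)
    then show ?case using LR[of "K n (k div 2)" "1 / real (Suc n)"] by (simp add: KS)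
  qed (use X in \<open>simp add: K0\<close>)
  have split: "L (1 / real (Suc n)) (K n k) \<inter> R (1 / real (Suc n)) (K n k) = {}" for n k
    using LR[of "K n k" "1 / real (Suc n)"] K by simp
  have sub: "K (Suc n) k \<subseteq> K n (k div 2)" for n k
    using LR[of "K n (k div 2)" "1 / real (Suc n)"] K by (simp add: KS)
  show ?thesis
  proof (rule that[of K])
    show "compact (K n k)" for n k using K by blast
    show "K n k \<noteq> {}" for n k using K[of n k] by auto
    show "K (Suc n) k \<subseteq> K n (k div 2)" for n k by (rule sub)
    show "\<exists>x. K (Suc n) k \<subseteq> cball x (1 / real (Suc n))" for n k
      using LR[of "K n (k div 2)" "1 / real (Suc n)"] K by (simp add: KS)
    show "K n k \<inter> K n l = {}" if "k < 2 ^ n" "l < 2 ^ n" "k \<noteq> l" for n k l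
      using that
    proof (induction n arbitrary: k l)
      case (Suc n)
      show ?case
      proof (cases "k div 2 = l div 2")
        case False
        with Suc.prems have "K n (k div 2) \<inter> K n (l div 2) = {}" by (intro Suc.IH) auto
        then show ?thesis using sub[of n k] sub[of n l] by blast
      next
        case True
        then have "even k \<noteq> even l" using Suc.prems(3) by presburger
        then show ?thesis using split[of n "k div 2"] True by (auto simp: KS)
      qed
    qed simp
  qed
qed

section \<open>Reading binary digits with continuous functions\<close>

lemma Urysohn_metric:
  fixes A B :: "'a::metric_space set"
  assumes "closed A" "closed B" "A \<noteq> {}" "B \<noteq> {}" "A \<inter> B = {}"
  obtains \<phi> :: "'a \<Rightarrow> real" where "continuous_on UNIV \<phi>" "\<And>x. \<phi> x \<in> {0..1}"
    "\<And>x. x \<in> A \<Longrightarrow> \<phi> x = 0" "\<And>x. x \<in> B \<Longrightarrow> \<phi> x = 1"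
proof -
  have A: "x \<in> A \<longleftrightarrow> infdist x A = 0" and B: "x \<in> B \<longleftrightarrow> infdist x B = 0" for x
    using assms by (auto simp: in_closed_iff_infdist_zero)
  have nz: "infdist x A + infdist x B \<noteq> 0" for x
    using A[of x] B[of x] assms(5) infdist_nonneg[of x A] infdist_nonneg[of x B] 
    by (metis IntI add_nonneg_eq_0_iff empty_iff)
  show ?thesis
  proof (rule that)
    show "continuous_on UNIV (\<lambda>x. infdist x A / (infdist x A + infdist x B))"
      using nz by (intro continuous_intros) auto
    show "infdist x A / (infdist x A + infdist x B) \<in> {0..1}" for x
      using infdist_nonneg[of x A] infdist_nonneg[of x B] nz[of x]
      by (simp add: divide_le_eq_1 less_le)
    show "infdist x A / (infdist x A + infdist x B) = 0" if "x \<in> A" for x using that A by simp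
    show "infdist x A / (infdist x A + infdist x B) = 1" if "x \<in> B" for x
      using that B nz[of x] by simp
  qed
qed

text \<open>Deleting the last binary digit of an address yields the address of its parent in the
  Cantor scheme.\<close>

lemma nat_floor_double_div_2: "nat \<lfloor>2 * x\<rfloor> div 2 = nat \<lfloor>x::real\<rfloor>"
proof -
  have "\<lfloor>x\<rfloor> = \<lfloor>2 * x\<rfloor> div 2"
    using floor_divide_real_eq_div[of 2 "2 * x"] by simp
  then show ?thesis by (simp add: nat_div_distrib')
qed

text \<open>The point \<open>g u\<close> is chosen in all the nested sets addressed by the binary
  digits of \<open>u\<close>. At each level a Urysohn function recovers one digit, and the binary
  series of these functions reassembles \<open>u\<close>.\<close>

lemma continuous_surjection_with_borel_section:
  assumes X: "compact (UNIV :: 'a::metric_space set)" "uncountable (UNIV :: 'a::metric_space set)"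
  obtains \<Phi> :: "'a::metric_space \<Rightarrow> real" and g :: "real \<Rightarrow> 'a::metric_space" where
    "continuous_on UNIV \<Phi>" "\<And>u. u \<in> {0..<1} \<Longrightarrow> \<Phi> (g u) = u"
    "g \<in> borel_measurable borel"
proof -
  obtain K :: "nat \<Rightarrow> nat \<Rightarrow> 'a set" where K: "\<And>n k. compact (K n k)" "\<And>n k. K n k \<noteq> {}"
    "\<And>n k. K (Suc n) k \<subseteq> K n (k div 2)"
    "\<And>n k l. k < 2 ^ n \<Longrightarrow> l < 2 ^ n \<Longrightarrow> k \<noteq> l \<Longrightarrow> K n k \<inter> K n l = {}"
    "\<And>n k. \<exists>x. K (Suc n) k \<subseteq> cball x (1 / real (Suc n))"
    using cantor_scheme[OF X] by blast
  \<comment> \<open>The first \<open>n\<close> binary digits of the fractional part, read as an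
    address. Taking \<open>frac\<close> gives every real a valid address, so \<open>g\<close> is
    defined on the whole line.\<close>
  define D where "D n u = nat \<lfloor>2 ^ n * frac (u::real)\<rfloor>" for n u
  have D_half: "D (Suc n) u div 2 = D n u" for n u
    unfolding D_def by (simp add: mult.assoc nat_floor_double_div_2)
  have D_real: "real (D n u) = of_int \<lfloor>2 ^ n * frac u\<rfloor>" for n u by (simp add: D_def)
  have D_less: "D n u < 2 ^ n" for n u
  proof -
    have "2 ^ n * frac u < 2 ^ n" by (simp add: frac_lt_1)
    then have "real (D n u) < real (2 ^ n)" unfolding D_real by (simp add: floor_less_iff)
    then show ?thesis using of_nat_less_iff by blast
  qed
  have D_mono: "K (m + n) (D (m + n) u) \<subseteq> K m (D m u)" for m n u
  proof (induction n)
    case (Suc n)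
    then show ?case using K(3)[of "m + n" "D (Suc (m + n)) u"] by (auto simp: D_half)
  qed simp
  have "\<exists>x. \<forall>n. x \<in> K n (D n u)" for u
  proof -
    have "UNIV \<inter> (\<Inter>n\<in>UNIV. K n (D n u)) \<noteq> {}"
    proof (rule compact_imp_fip_image[OF X(1)])
      show "closed (K n (D n u))" for n using K(1) by (rule compact_imp_closed)
      fix I :: "nat set" assume "finite I"
      then obtain N where "\<forall>n\<in>I. n \<le> N" unfolding finite_nat_set_iff_bounded_le ..
      then have N: "n \<le> N" if "n \<in> I" for n using that by blast
      have "K N (D N u) \<subseteq> K n (D n u)" if "n \<in> I" for n
        using D_mono[of n "N - n" u] N[OF that] by simp
      moreover obtain z where "z \<in> K N (D N u)" using K(2)[of N "D N u"] by auto
      ultimately have "z \<in> UNIV \<inter> (\<Inter>n\<in>I. K n (D n u))" by auto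
      then show "UNIV \<inter> (\<Inter>n\<in>I. K n (D n u)) \<noteq> {}" by auto
    qed
    then show ?thesis by auto
  qed
  then obtain g where g: "\<And>u n. g u \<in> K n (D n u)" by metis
  \<comment> \<open>Fixed representatives of the cells. The map \<open>p n (D n u)\<close> depends
    on \<open>u\<close> only through an integer, hence is Borel, and for positive \<open>n\<close>
    it is within \<open>2 / n\<close> of \<open>g u\<close>; this makes the arbitrary choice of
    \<open>g\<close> measurable.\<close>
  define p where "p n k = (SOME x. x \<in> K n k)" for n k
  have p: "p n k \<in> K n k" for n k
    unfolding p_def using K(2)[of n k] by (simp add: some_in_eq)
  have g_lim: "(\<lambda>n. p n (D n u)) \<longlonglongrightarrow> g u" for u
  proof (rule LIMSEQ_imp_Suc, rule metric_tendsto_imp_tendsto)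
    show "(\<lambda>n. 2 * (1 / real (Suc n))) \<longlonglongrightarrow> 2 * 0"
      by (intro tendsto_intros LIMSEQ_Suc lim_1_over_n)
    show "\<forall>\<^sub>F n in sequentially. dist (p (Suc n) (D (Suc n) u)) (g u) \<le> dist (2 * (1 / real (Suc n))) (2 * 0)"
    proof (intro always_eventually allI)
      fix n
      obtain x where "K (Suc n) (D (Suc n) u) \<subseteq> cball x (1 / real (Suc n))" using K(5) by blast
      then have "dist x (p (Suc n) (D (Suc n) u)) \<le> 1 / real (Suc n)" "dist x (g u) \<le> 1 / real (Suc n)"
        using p g by (meson mem_cball subsetD)+
      then show "dist (p (Suc n) (D (Suc n) u)) (g u) \<le> dist (2 * (1 / real (Suc n))) (2 * 0)"
        using dist_triangle3[of "p (Suc n) (D (Suc n) u)" "g u" x] by (simp add: dist_real_def)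
    qed
  qed
  have g_meas: "g \<in> borel_measurable borel"
  proof (rule borel_measurable_LIMSEQ_metric)
    show "(\<lambda>n. p n (D n u)) \<longlonglongrightarrow> g u" for u by (rule g_lim)
    show "(\<lambda>u. p n (D n u)) \<in> borel_measurable borel" for n
    proof -
      have "(\<lambda>u. \<lfloor>2 ^ n * frac (u::real)\<rfloor>) \<in> borel \<rightarrow>\<^sub>M count_space UNIV"
        unfolding frac_def by measurable
      then show ?thesis
        unfolding D_def by (rule measurable_compose) simp
    qed
  qed
  \<comment> \<open>The cells of level \<open>n + 1\<close> whose last digit is 0, and below those
    whose last digit is 1: two disjoint closed sets, being finite unions of compact ones.\<close>
  define E where "E n = (\<Union>k\<in>{k. k < 2 ^ Suc n \<and> even k}. K (Suc n) k)" for n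
  define O' where "O' n = (\<Union>k\<in>{k. k < 2 ^ Suc n \<and> odd k}. K (Suc n) k)" for n
  have "\<exists>\<phi>. continuous_on UNIV \<phi> \<and> (\<forall>x. \<phi> x \<in> {0..1::real}) \<and> (\<forall>x\<in>E n. \<phi> x = 0) \<and> (\<forall>x\<in>O' n. \<phi> x = 1)" for n
  proof (rule Urysohn_metric[of "E n" "O' n"])
    show "closed (E n)" "closed (O' n)"
      unfolding E_def O'_def using K(1) by (auto intro!: closed_UN compact_imp_closed)
    have "0 \<in> {k. k < 2 ^ Suc n \<and> even (k::nat)}" "1 \<in> {k. k < 2 ^ Suc n \<and> odd (k::nat)}"
      using one_less_power[of "2::nat" "Suc n"] by auto
    then show "E n \<noteq> {}" "O' n \<noteq> {}"
      unfolding E_def O'_def using K(2) by blast+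
    show "E n \<inter> O' n = {}"
      unfolding E_def O'_def using K(4)[of _ "Suc n"] by fastforce
  qed blast
  then obtain \<phi> where \<phi>: "\<And>n. continuous_on UNIV (\<phi> n)" "\<And>n x. \<phi> n x \<in> {0..1::real}"
    "\<And>n x. x \<in> E n \<Longrightarrow> \<phi> n x = 0" "\<And>n x. x \<in> O' n \<Longrightarrow> \<phi> n x = 1"
    by metis
  define \<Phi> where "\<Phi> x = (\<Sum>n. \<phi> n x * (1/2) ^ Suc n)" for x
  have "uniform_limit UNIV (\<lambda>N x. \<Sum>n<N. \<phi> n x * (1/2) ^ Suc n) (\<lambda>x. \<Sum>n. \<phi> n x * (1/2) ^ Suc n) sequentially"
  proof (rule Weierstrass_m_test)
    show "norm (\<phi> n x * (1/2) ^ Suc n) \<le> (1/2) ^ Suc n" for n x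
      using \<phi>(2)[of n x] by (auto simp: abs_mult mult_le_cancel_right1 simp del: power_Suc)
    show "summable (\<lambda>n. (1/2::real) ^ Suc n)"
      using power_half_series by (rule sums_summable)
  qed
  then have cont: "continuous_on UNIV \<Phi>"
    unfolding \<Phi>_def
    by (rule uniform_limit_theorem[rotated]) (use \<phi>(1) in \<open>auto intro!: always_eventually continuous_intros\<close>)
  have \<Phi>g: "\<Phi> (g u) = u" if u: "u \<in> {0..<1}" for u
  proof -
    have fr: "frac u = u" using u by (simp add: frac_eq)
    \<comment> \<open>Going down one level doubles the address and adds the new digit, so the
      weighted digits telescope to \<open>real (D N u) / 2 ^ N\<close>.\<close>
    have bit: "\<phi> n (g u) = real (D (Suc n) u) - 2 * real (D n u)" for n
    proof (cases "even (D (Suc n) u)")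
      case True
      then have "g u \<in> E n" unfolding E_def using g[of u "Suc n"] D_less[of "Suc n" u] by blast
      moreover have "D (Suc n) u = 2 * D n u" using True D_half[of n u] by auto
      ultimately show ?thesis using \<phi>(3) by simp
    next
      case False
      then have "g u \<in> O' n" unfolding O'_def using g[of u "Suc n"] D_less[of "Suc n" u] by blast
      moreover have "D (Suc n) u = 2 * D n u + 1" using False D_half[of n u] by presburger
      ultimately show ?thesis using \<phi>(4) by simp
    qed
    have "D 0 u = 0" using D_less[of 0 u] by simp
    then have partial: "(\<Sum>n<N. \<phi> n (g u) * (1/2) ^ Suc n) = real (D N u) / 2 ^ N" for N
      by (induction N) (auto simp: bit field_simps power_one_over)
    have "(\<lambda>N. real (D N u) / 2 ^ N) \<longlonglongrightarrow> u"
    proof (rule tendsto_sandwich[of "\<lambda>N. u - (1/2) ^ N" _ _ "\<lambda>_. u"])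
      have le: "real (D N u) \<le> 2 ^ N * u" "2 ^ N * u \<le> real (D N u) + 1" for N
        unfolding D_real fr by linarith+
      show "\<forall>\<^sub>F N in sequentially. u - (1/2) ^ N \<le> real (D N u) / 2 ^ N"
      proof (intro always_eventually allI)
        show "u - (1/2) ^ N \<le> real (D N u) / 2 ^ N" for N
          using divide_right_mono[OF le(2)[of N], of "2 ^ N"]
          by (simp add: add_divide_distrib power_one_over)
      qed
      show "\<forall>\<^sub>F N in sequentially. real (D N u) / 2 ^ N \<le> u"
        using le(1) by (intro always_eventually allI) (simp add: field_simps)
      have "(\<lambda>N. u - (1/2::real) ^ N) \<longlonglongrightarrow> u - 0"
        by (intro tendsto_intros LIMSEQ_realpow_zero) auto
      then show "(\<lambda>N. u - (1/2::real) ^ N) \<longlonglongrightarrow> u" by simp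
    qed simp
    then have "(\<lambda>n. \<phi> n (g u) * (1/2) ^ Suc n) sums u"
      unfolding sums_def partial .
    then show ?thesis unfolding \<Phi>_def by (rule sums_unique[symmetric])
  qed
  show ?thesis using that[OF cont \<Phi>g g_meas] .
qed

section \<open>The energy method\<close>

text \<open>
  Comparable to \<open>\<bar>x\<bar> powr - s\<close> for small \<open>x\<close>, but infinite at \<open>0\<close>, where \<open>0 powr - s = 0\<close>
  would hide atoms of the image measure.
\<close>

definition dyadic_kernel :: "real \<Rightarrow> real \<Rightarrow> ennreal" where
  "dyadic_kernel s x = (\<Sum>k. ennreal ((2 ^ k) powr s) * indicator (cball 0 ((1/2) ^ k)) x)"

lemma borel_measurable_dyadic_kernel[measurable]: "dyadic_kernel s \<in> borel_measurable borel"
  unfolding dyadic_kernel_def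
  by (intro borel_measurable_suminf_order borel_measurable_times_ennreal borel_measurable_indicator) auto

text \<open>A single term suffices: that of the last scale \<open>(1/2) ^ k\<close> which is at
  least \<open>d\<close>. The next scale is below \<open>d\<close>, so \<open>2 ^ k\<close> is at
  least \<open>inverse (2 * d)\<close>.\<close>

lemma dyadic_kernel_ge:
  assumes s: "0 < s" and d: "0 < d" "d \<le> 1" and x: "\<bar>x\<bar> \<le> d"
  shows "ennreal ((2 * d) powr (- s)) \<le> dyadic_kernel s x"
proof -
  have ex: "\<exists>n. (1/2) ^ n < d" using real_arch_pow_inv[of d "1/2"] d by auto
  define n where "n = (LEAST n. (1/2) ^ n < d)"
  have n: "(1/2) ^ n < d" unfolding n_def using ex by (rule LeastI_ex)
  with d obtain k where k: "n = Suc k" by (cases n) auto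
  then have "\<not> (1/2) ^ k < d" using not_less_Least[of k "\<lambda>n. (1/2) ^ n < d"] n_def by simp
  then have dk: "d \<le> (1/2) ^ k" by simp
  have "inverse (2 * d) \<le> 2 ^ k"
    using n d by (simp add: k field_simps power_one_over)
  then have "(2 * d) powr (- s) \<le> (2 ^ k) powr s"
    using powr_mono2[of s "inverse (2 * d)" "2 ^ k"] inverse_powr[of "2 * d" s] s d
    by (simp only: powr_minus) simp
  then have "ennreal ((2 * d) powr (- s)) \<le> ennreal ((2 ^ k) powr s) * indicator (cball 0 ((1/2) ^ k)) x"
    using x dk by (auto simp: indicator_def intro: ennreal_leI)
  also have "\<dots> \<le> dyadic_kernel s x"
    unfolding dyadic_kernel_def
    using sum_le_suminf[of "\<lambda>k. ennreal ((2 ^ k) powr s) * indicator (cball 0 ((1/2) ^ k)) x" "{k}"]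
    by (simp del: sum_mult_indicator)
  finally show ?thesis .
qed

text \<open>Ensures that \<open>(2 * d) powr s\<close> can be inverted when \<open>d\<close> is the
  diameter of a covering set in the energy estimate.\<close>

lemma diameter_open_pos:
  fixes V :: "real set"
  assumes "open V" "bounded V" "V \<noteq> {}"
  shows "0 < diameter V"
proof -
  obtain x where x: "x \<in> V" using assms by blast
  then obtain e where e: "0 < e" "ball x e \<subseteq> V" using assms(1) open_contains_ball by blast
  then have "x + e / 2 \<in> V" by (auto simp: dist_real_def)
  with x have "dist x (x + e / 2) \<le> diameter V"
    using assms(2) by (intro diameter_bounded_bound)
  with e show ?thesis by (simp add: dist_real_def)
qed

text \<open>A mass distribution argument. Where the potential \<open>\<Psi>\<close> is at most
  \<open>n\<close>, a covering set of small diameter \<open>d\<close> captures mass at most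
  \<open>(2 * d) powr s * n\<close>, since the kernel is at least \<open>(2 * d) powr (- s)\<close>
  between its points. Covers of arbitrarily small total would make each \<open>A n\<close> null, yet
  finite energy means that the \<open>A n\<close> exhaust the space up to a null set.\<close>

lemma finite_energy_imp_hausdorff_measure_pos:
  fixes h :: "'a \<Rightarrow> real"
  assumes M: "sigma_finite_measure M" and h[measurable]: "h \<in> borel_measurable M"
    and pos: "emeasure M (space M) \<noteq> 0" and s: "0 < s"
    and energy: "(\<integral>\<^sup>+u. \<integral>\<^sup>+v. dyadic_kernel s (h u - h v) \<partial>M \<partial>M) \<noteq> \<infinity>"
  shows "hausdorff_measure s (h ` space M) \<noteq> 0"
proof
  assume null: "hausdorff_measure s (h ` space M) = 0"
  interpret sigma_finite_measure M by (rule M)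
  define \<Psi> where "\<Psi> u = (\<integral>\<^sup>+v. dyadic_kernel s (h u - h v) \<partial>M)" for u
  have [measurable]: "\<Psi> \<in> borel_measurable M" unfolding \<Psi>_def by measurable
  define A where "A n = {u \<in> space M. \<Psi> u \<le> of_nat n}" for n :: nat
  have [measurable]: "A n \<in> sets M" for n unfolding A_def by measurable
  have "emeasure M (A n) = 0" for n
    unfolding ennreal_eq_0_iff_less
  proof (intro allI impI)
    fix \<epsilon> :: real assume \<epsilon>: "0 < \<epsilon>"
    define c where "c = 2 powr s * real n"
    have c: "0 \<le> c" by (simp add: c_def)
    \<comment> \<open>The bound 1 forces the diameters to be at most 1, as
      \<open>dyadic_kernel_ge\<close> demands; the other bound makes \<open>c * \<eta>\<close> less
      than \<epsilon>. Adding 1 to \<open>c\<close> covers the case \<open>n = 0\<close>.\<close>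
    define \<eta> where "\<eta> = min 1 (\<epsilon> / (2 * (c + 1)))"
    have \<eta>: "0 < \<eta>" "\<eta> \<le> 1" using c \<epsilon> by (auto simp: \<eta>_def)
    obtain V :: "nat \<Rightarrow> real set" where V: "\<And>i. open (V i)" "\<And>i. bounded (V i)" "h ` space M \<subseteq> (\<Union>i. V i)"
        "(\<Sum>i. diam_pow s (V i)) < ennreal \<eta>"
      using null[unfolded hausdorff_measure_eq_0_open_cover_iff[OF s], rule_format, OF \<eta>(1)] by blast
    have [measurable]: "V i \<in> sets borel" for i using V(1) by simp
    have bound: "emeasure M (A n \<inter> (h -` V i \<inter> space M)) \<le> ennreal c * diam_pow s (V i)" for i
    proof (cases "A n \<inter> (h -` V i \<inter> space M) = {}")
      case False
      then obtain u where u: "u \<in> A n" "h u \<in> V i" by blast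
      define d where "d = diameter (V i)"
      have d: "0 < d" unfolding d_def using V u by (intro diameter_open_pos) auto
      have "diam_pow s (V i) < ennreal \<eta>" using ennreal_suminf_lessD[OF V(4)] .
      then have "d powr s < 1"
        using u s \<eta> by (auto simp: diam_pow_def d_def ennreal_less_iff split: if_splits)
      then have "d \<le> 1" using s d powr_mono2[of s 1 d] by (cases "d \<le> 1") auto
      note d = d this
      define a where "a = (2 * d) powr s"
      have a: "0 < a" using d by (simp add: a_def)
      let ?m = "emeasure M (A n \<inter> (h -` V i \<inter> space M))"
      have "ennreal (inverse a) * ?m = (\<integral>\<^sup>+v. ennreal (inverse a) * indicator (A n \<inter> (h -` V i \<inter> space M)) v \<partial>M)"
        by (subst nn_integral_cmult_indicator) auto
      also have "\<dots> \<le> \<Psi> u"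
        unfolding \<Psi>_def
      proof (intro nn_integral_mono)
        fix v
        have "ennreal (inverse a) \<le> dyadic_kernel s (h u - h v)" if "h v \<in> V i"
        proof -
          have "dist (h u) (h v) \<le> d"
            unfolding d_def using u(2) that V(2) by (intro diameter_bounded_bound)
          then show ?thesis
            using dyadic_kernel_ge[OF s d, of "h u - h v"] by (simp add: a_def powr_minus dist_real_def)
        qed
        then show "ennreal (inverse a) * indicator (A n \<inter> (h -` V i \<inter> space M)) v \<le> dyadic_kernel s (h u - h v)"
          by (auto simp: indicator_def)
      qed
      also have "\<dots> \<le> ennreal (real n)" using u by (simp add: A_def ennreal_of_nat_eq_real_of_nat)
      finally have "ennreal a * (ennreal (inverse a) * ?m) \<le> ennreal a * ennreal (real n)"
        by (intro mult_left_mono) auto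
      then have "?m \<le> ennreal a * ennreal (real n)"
        using a by (simp add: mult.assoc[symmetric] ennreal_mult[symmetric])
      also have "\<dots> = ennreal c * diam_pow s (V i)"
        using u s d by (auto simp: diam_pow_def c_def a_def d_def ennreal_mult[symmetric] powr_mult mult_ac)
      finally show ?thesis .
    qed simp
    have "emeasure M (A n) \<le> emeasure M (\<Union>i. A n \<inter> (h -` V i \<inter> space M))"
      using V(3) unfolding A_def by (intro emeasure_mono) (blast, measurable)
    also have "\<dots> \<le> (\<Sum>i. emeasure M (A n \<inter> (h -` V i \<inter> space M)))"
      by (intro emeasure_subadditive_countably) auto
    also have "\<dots> \<le> (\<Sum>i. ennreal c * diam_pow s (V i))"
      using bound by (intro suminf_le) auto
    also have "\<dots> = ennreal c * (\<Sum>i. diam_pow s (V i))" by simp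
    also have "\<dots> \<le> ennreal c * ennreal \<eta>" using V(4) by (intro mult_left_mono) auto
    also have "\<dots> = ennreal (c * \<eta>)" using c \<eta> by (simp add: ennreal_mult)
    also have "\<dots> < ennreal \<epsilon>"
    proof -
      have "c * \<eta> \<le> c * (\<epsilon> / (2 * (c + 1)))" using c by (intro mult_left_mono) (auto simp: \<eta>_def)
      also have "\<dots> < \<epsilon>" using mult_nonneg_nonneg[OF c, of \<epsilon>] c \<epsilon> by (simp add: field_simps add_nonneg_pos)
      finally show ?thesis using c \<eta> by (simp add: ennreal_less_iff)
    qed
    finally show "emeasure M (A n) < ennreal \<epsilon>" .
  qed
  then have "AE u in M. \<forall>n. u \<notin> A n"
    by (subst AE_all_countable) (auto intro!: AE_not_in simp: null_sets_def)
  moreover have "AE u in M. \<Psi> u \<noteq> \<infinity>"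
    using energy unfolding \<Psi>_def[symmetric] by (intro nn_integral_PInf_AE) auto
  ultimately have "AE u in M. False"
    using AE_space
  proof (eventually_elim, goal_cases)
    case (1 u)
    then obtain n where "\<Psi> u < of_nat n" using ennreal_Ex_less_of_nat[of "\<Psi> u"] by (auto simp: less_top)
    then have "u \<in> A n" using 1(3) by (simp add: A_def less_imp_le)
    with 1(1) show ?case by blast
  qed
  then have "space M \<in> null_sets M" by (simp add: AE_iff_null)
  with pos show False by auto
qed

section \<open>Averaging the energy along the probe\<close>

lemma min_le_powr_interpolate:
  assumes "0 \<le> (x::real)" "0 \<le> y" "0 < p" "p < 1"
  shows "min x y \<le> x powr (1 - p) * y powr p"
proof -
  have "min x y = min x y powr (1 - p) * min x y powr p"
    using assms by (cases "min x y = 0") (auto simp: powr_add[symmetric])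
  also have "\<dots> \<le> x powr (1 - p) * y powr p"
    using assms by (intro mult_mono powr_mono2) auto
  finally show ?thesis .
qed

text \<open>The times in \<open>{-T..T}\<close> at which \<open>a + t * b\<close> lies within
  \<open>(1/2) ^ k\<close> of 0 have measure at most both \<open>2 * T\<close> and
  \<open>2 * (1/2) ^ k / \<bar>b\<bar>\<close>. Interpolating the two with exponent \<open>p\<close>
  and weighting by \<open>(2 ^ k) powr s\<close> leaves a geometric series of ratio
  \<open>2 powr (s - p)\<close>, uniformly in \<open>a\<close>.\<close>

lemma nn_integral_dyadic_kernel_line:
  assumes s: "0 < s" "s < p" "p < 1" and T: "0 < T"
  obtains C where "0 \<le> C" "\<And>a b. b \<noteq> 0 \<Longrightarrow>
    (\<integral>\<^sup>+t\<in>{-T..T}. dyadic_kernel s (a + t * b) \<partial>lborel) \<le> ennreal (C * \<bar>b\<bar> powr (- p))"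
proof -
  define q where "q = 2 powr (s - p)"
  have q: "0 < q" "q < 1" using s by (auto simp: q_def powr_less_one)
  define C where "C = (2 * T) powr (1 - p) * 2 powr p * (1 / (1 - q))"
  show ?thesis
  proof (rule that[of C])
    show "0 \<le> C" using q by (simp add: C_def)
    fix a b :: real assume b: "b \<noteq> 0"
    have scale: "(\<integral>\<^sup>+t\<in>{-T..T}. ennreal ((2 ^ k) powr s) * indicator (cball 0 ((1/2) ^ k)) (a + t * b) \<partial>lborel)
      \<le> ennreal ((2 * T) powr (1 - p) * 2 powr p * \<bar>b\<bar> powr (- p) * q ^ k)" for k
    proof -
      define r where "r = (1/2::real) ^ k"
      have r: "0 < r" by (simp add: r_def)
      let ?c = "- a / b"
      let ?S = "{-T..T} \<inter> {?c - r / \<bar>b\<bar>..?c + r / \<bar>b\<bar>}"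
      have sub: "t \<in> {?c - r / \<bar>b\<bar>..?c + r / \<bar>b\<bar>}" if "\<bar>a + t * b\<bar> \<le> r" for t
      proof -
        have "a + t * b = b * (t - ?c)" using b by (simp add: field_simps)
        then have "\<bar>b\<bar> * \<bar>t - ?c\<bar> \<le> r" using that by (simp add: abs_mult)
        then have "\<bar>t - ?c\<bar> \<le> r / \<bar>b\<bar>" using b by (simp add: field_simps)
        then show ?thesis by (simp only: abs_le_iff) auto
      qed
      have m1: "emeasure lborel ?S \<le> ennreal (2 * T)"
        by (rule order_trans[OF emeasure_mono[of _ "{-T..T}"]]) (use T in auto)
      have m2: "emeasure lborel ?S \<le> ennreal (2 * r / \<bar>b\<bar>)"
        by (rule order_trans[OF emeasure_mono[of _ "{?c - r / \<bar>b\<bar>..?c + r / \<bar>b\<bar>}"]]) (use r b in auto)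
      have "(\<integral>\<^sup>+t\<in>{-T..T}. ennreal ((2 ^ k) powr s) * indicator (cball 0 ((1/2) ^ k)) (a + t * b) \<partial>lborel)
        \<le> (\<integral>\<^sup>+t. ennreal ((2 ^ k) powr s) * indicator ?S t \<partial>lborel)"
        using sub by (intro nn_integral_mono) (auto simp: indicator_def r_def)
      also have "\<dots> = ennreal ((2 ^ k) powr s) * emeasure lborel ?S"
        by (intro nn_integral_cmult_indicator) auto
      also have "\<dots> \<le> ennreal ((2 ^ k) powr s) * ennreal (min (2 * T) (2 * r / \<bar>b\<bar>))"
        using m1 m2 by (intro mult_left_mono) (auto simp: min_def)
      also have "\<dots> \<le> ennreal ((2 ^ k) powr s * ((2 * T) powr (1 - p) * (2 * r / \<bar>b\<bar>) powr p))"
        using T r s min_le_powr_interpolate[of "2 * T" "2 * r / \<bar>b\<bar>" p]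
        by (simp add: ennreal_mult[symmetric] ennreal_leI mult_left_mono)
      also have "(2 ^ k) powr s * ((2 * T) powr (1 - p) * (2 * r / \<bar>b\<bar>) powr p) =
          (2 * T) powr (1 - p) * 2 powr p * \<bar>b\<bar> powr (- p) * ((2 ^ k) powr s * r powr p)"
        using r b by (simp add: powr_mult powr_divide powr_minus field_simps)
      also have "(2 ^ k) powr s * r powr p = q ^ k"
      proof -
        have "(2 ^ k) powr s = 2 powr (real k * s)"
          by (subst powr_realpow[symmetric]) (auto simp: powr_powr)
        moreover have "r = 2 powr (- real k)"
          by (simp add: r_def powr_minus powr_realpow power_one_over inverse_eq_divide)
        moreover have "q ^ k = 2 powr (real k * (s - p))"
          unfolding q_def by (subst powr_realpow[symmetric]) (auto simp: powr_powr mult.commute)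
        ultimately show ?thesis by (simp add: powr_powr powr_add[symmetric] right_diff_distrib)
      qed
      finally show ?thesis .
    qed
    define G where "G k t = ennreal ((2 ^ k) powr s) * indicator (cball 0 ((1/2) ^ k)) (a + t * b) *
      indicator {-T..T} t" for k :: nat and t
    have G: "G k \<in> borel_measurable lborel" for k
    proof -
      have "(\<lambda>t. indicator (cball 0 ((1/2) ^ k)) (a + t * b) :: ennreal) \<in> borel_measurable lborel"
        by (rule measurable_compose[of _ _ borel, OF _ borel_measurable_indicator]) auto
      then show ?thesis unfolding G_def by (intro borel_measurable_times_ennreal) auto
    qed
    have "(\<integral>\<^sup>+t\<in>{-T..T}. dyadic_kernel s (a + t * b) \<partial>lborel) = (\<integral>\<^sup>+t. (\<Sum>k. G k t) \<partial>lborel)"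
      by (simp add: dyadic_kernel_def G_def)
    also have "\<dots> = (\<Sum>k. \<integral>\<^sup>+t. G k t \<partial>lborel)"
      by (rule nn_integral_suminf) (rule G)
    also have "\<dots> \<le> (\<Sum>k. ennreal ((2 * T) powr (1 - p) * 2 powr p * \<bar>b\<bar> powr (- p) * q ^ k))"
      unfolding G_def by (intro suminf_le scale) auto
    also have "\<dots> = ennreal (\<Sum>k. (2 * T) powr (1 - p) * 2 powr p * \<bar>b\<bar> powr (- p) * q ^ k)"
      using q by (intro suminf_ennreal2) (auto intro!: summable_mult summable_geometric)
    also have "(\<Sum>k. (2 * T) powr (1 - p) * 2 powr p * \<bar>b\<bar> powr (- p) * q ^ k) = C * \<bar>b\<bar> powr (- p)"
      using q by (subst suminf_mult) (auto simp: summable_geometric suminf_geometric C_def)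
    finally show "(\<integral>\<^sup>+t\<in>{-T..T}. dyadic_kernel s (a + t * b) \<partial>lborel) \<le> ennreal (C * \<bar>b\<bar> powr (- p))" .
  qed
qed

lemma nn_integral_abs_powr_unit_interval_finite:
  assumes p: "p < 1"
  shows "(\<integral>\<^sup>+w\<in>{-1..1}. ennreal (\<bar>w\<bar> powr (- p)) \<partial>lborel) < \<infinity>"
proof -
  let ?f = "\<lambda>w::real. ennreal (\<bar>w\<bar> powr (- p))"
  have "((\<lambda>w. \<bar>w\<bar> powr (- p)) has_integral (1 powr (- p + 1) / (- p + 1))) {0..1::real}"
    using has_integral_powr_from_0[of "- p" 1] p
    by (subst has_integral_cong[of _ _ "\<lambda>w. w powr (- p)"]) auto
  moreover have "(\<lambda>w. indicator {0..1} w * \<bar>w\<bar> powr (- p)) =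
      (\<lambda>w. if w \<in> {0..1} then \<bar>w\<bar> powr (- p) else 0)"
    by (auto simp: indicator_def)
  ultimately have "((\<lambda>w. indicator {0..1} w * \<bar>w\<bar> powr (- p)) has_integral (1 powr (- p + 1) / (- p + 1))) UNIV"
    by (simp only: has_integral_restrict_UNIV)
  then have right: "(\<integral>\<^sup>+w. ennreal (indicator {0..1} w * \<bar>w\<bar> powr (- p)) \<partial>lborel) < \<infinity>"
    by (subst nn_integral_has_integral_lborel) auto
  have right: "(\<integral>\<^sup>+w\<in>{0..1}. ?f w \<partial>lborel) < \<infinity>"
    using right by (simp add: ennreal_mult' mult.commute ennreal_indicator)
  have "(\<integral>\<^sup>+w\<in>{-1..0}. ?f w \<partial>lborel) = (\<integral>\<^sup>+w\<in>{0..1}. ?f w \<partial>lborel)"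
    by (subst nn_integral_real_affine[where c = "-1" and t = 0])
       (auto intro!: nn_integral_cong simp: indicator_def)
  with right have "(\<integral>\<^sup>+w\<in>{-1..0}. ?f w \<partial>lborel) + (\<integral>\<^sup>+w\<in>{0..1}. ?f w \<partial>lborel) < \<infinity>" by simp
  moreover have "(\<integral>\<^sup>+w\<in>{-1..1}. ?f w \<partial>lborel) \<le> (\<integral>\<^sup>+w\<in>{-1..0}. ?f w \<partial>lborel) + (\<integral>\<^sup>+w\<in>{0..1}. ?f w \<partial>lborel)"
    by (subst nn_integral_add[symmetric]) (auto intro!: nn_integral_mono simp: indicator_def)
  ultimately show ?thesis by (rule le_less_trans[rotated])
qed

text \<open>For fixed \<open>u\<close> the difference \<open>u - v\<close> stays in
  \<open>{-1..1}\<close>, which bounds the inner integral uniformly in \<open>u\<close>.\<close>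

lemma riesz_energy_unit_interval_finite:
  assumes p: "p < 1"
  shows "(\<integral>\<^sup>+u. \<integral>\<^sup>+v. ennreal (\<bar>u - v\<bar> powr (- p)) \<partial>restrict_space lborel {0..<1}
    \<partial>restrict_space lborel {0..<1::real}) < \<infinity>"
proof -
  let ?B = "\<integral>\<^sup>+w\<in>{-1..1}. ennreal (\<bar>w\<bar> powr (- p)) \<partial>lborel"
  have "(\<integral>\<^sup>+v. ennreal (\<bar>u - v\<bar> powr (- p)) \<partial>restrict_space lborel {0..<1}) \<le> ?B" if "u \<in> {0..<1}" for u :: real
  proof -
    have "(\<integral>\<^sup>+v. ennreal (\<bar>u - v\<bar> powr (- p)) \<partial>restrict_space lborel {0..<1}) =
        (\<integral>\<^sup>+v\<in>{0..<1}. ennreal (\<bar>u - v\<bar> powr (- p)) \<partial>lborel)"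
      by (subst nn_integral_restrict_space) auto
    also have "\<dots> \<le> (\<integral>\<^sup>+v. ennreal (\<bar>u + (-1) * v\<bar> powr (- p)) * indicator {-1..1} (u + (-1) * v) \<partial>lborel)"
      using that by (intro nn_integral_mono) (auto simp: indicator_def)
    also have "\<dots> = ?B"
      by (subst nn_integral_real_affine[where c = "-1" and t = u]) auto
    finally show ?thesis .
  qed
  then have "(\<integral>\<^sup>+u. \<integral>\<^sup>+v. ennreal (\<bar>u - v\<bar> powr (- p)) \<partial>restrict_space lborel {0..<1}
    \<partial>restrict_space lborel {0..<1::real}) \<le> (\<integral>\<^sup>+u. ?B \<partial>restrict_space lborel {0..<1::real})"
    by (intro nn_integral_mono) (auto simp: space_restrict_space)
  also have "\<dots> = ?B" by (simp add: space_restrict_space emeasure_restrict_space)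
  also have "\<dots> < \<infinity>" using p by (rule nn_integral_abs_powr_unit_interval_finite)
  finally show ?thesis .
qed

text \<open>Transversality: as \<open>t\<close> varies, the images of \<open>u\<close> and
  \<open>v\<close> move apart at speed \<open>u - v\<close>, whatever \<open>F\<close> is. By Fubini
  the energy integrated over bounded \<open>t\<close> is therefore at most a constant times the
  Riesz energy of Lebesgue measure.\<close>

lemma AE_hausdorff_measure_image_pos:
  fixes F :: "real \<Rightarrow> real"
  assumes F: "F \<in> borel_measurable borel" and s: "0 < s" "s < 1"
  shows "AE t in lborel. hausdorff_measure s ((\<lambda>u. F u + t * u) ` {0..<1}) \<noteq> 0"
proof -
  define M where "M = restrict_space lborel {0..<1::real}"
  have space_M: "space M = {0..<1}" by (simp add: M_def space_restrict_space)
  interpret M: sigma_finite_measure M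
    unfolding M_def by (intro sigma_finite_measure_restrict_space lborel.sigma_finite_measure_axioms) auto
  have F_M[measurable]: "F \<in> borel_measurable M" and id_M[measurable]: "(\<lambda>u. u) \<in> borel_measurable M"
    unfolding M_def using F by (auto intro: measurable_restrict_space1)
  have pos: "emeasure M (space M) \<noteq> 0"
    unfolding space_M by (simp add: M_def emeasure_restrict_space)
  \<comment> \<open>The gap above \<open>s\<close> makes the dyadic series converge, and
    \<open>p < 1\<close> makes the Riesz energy finite.\<close>
  obtain p where p: "s < p" "p < 1" using s dense by blast
  have "AE t in lborel. t \<in> {- T..T} \<longrightarrow> hausdorff_measure s ((\<lambda>u. F u + t * u) ` {0..<1}) \<noteq> 0"
    if T: "0 < T" for T
  proof -
    define N where "N = restrict_space lborel {- T..T}"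
    interpret N: sigma_finite_measure N
      unfolding N_def by (intro sigma_finite_measure_restrict_space lborel.sigma_finite_measure_axioms) auto
    have id_N[measurable]: "(\<lambda>t. t) \<in> borel_measurable N"
      unfolding N_def by (auto intro: measurable_restrict_space1)
    interpret NM: pair_sigma_finite N M ..
    let ?h = "\<lambda>t u. F u + t * u"
    let ?I = "\<lambda>t. \<integral>\<^sup>+u. \<integral>\<^sup>+v. dyadic_kernel s (?h t u - ?h t v) \<partial>M \<partial>M"
    obtain C where C: "0 \<le> C" "\<And>a b. b \<noteq> 0 \<Longrightarrow>
        (\<integral>\<^sup>+t\<in>{-T..T}. dyadic_kernel s (a + t * b) \<partial>lborel) \<le> ennreal (C * \<bar>b\<bar> powr (- p))"
      using nn_integral_dyadic_kernel_line[OF s(1) p T] by blast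
    have "(\<integral>\<^sup>+t. ?I t \<partial>N) = (\<integral>\<^sup>+u. \<integral>\<^sup>+t. \<integral>\<^sup>+v. dyadic_kernel s (?h t u - ?h t v) \<partial>M \<partial>N \<partial>M)"
      by (intro NM.Fubini'[symmetric]) measurable
    also have "\<dots> = (\<integral>\<^sup>+u. \<integral>\<^sup>+v. \<integral>\<^sup>+t. dyadic_kernel s (?h t u - ?h t v) \<partial>N \<partial>M \<partial>M)"
      by (intro nn_integral_cong NM.Fubini'[symmetric]) measurable
    also have "\<dots> \<le> (\<integral>\<^sup>+u. \<integral>\<^sup>+v. ennreal C * ennreal (\<bar>u - v\<bar> powr (- p)) \<partial>M \<partial>M)"
    proof (rule nn_integral_mono, rule nn_integral_mono_AE)
      fix u
      \<comment> \<open>The line estimate requires a nonzero slope \<open>u - v\<close>; the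
        excluded diagonal is a null set.\<close>
      have "AE v in M. v \<noteq> u"
        unfolding M_def using AE_lborel_singleton[of u] by (subst AE_restrict_space_iff) auto
      then show "AE v in M. (\<integral>\<^sup>+t. dyadic_kernel s (?h t u - ?h t v) \<partial>N) \<le> ennreal C * ennreal (\<bar>u - v\<bar> powr (- p))"
      proof eventually_elim
        case (elim v)
        have "(\<integral>\<^sup>+t. dyadic_kernel s (?h t u - ?h t v) \<partial>N) =
            (\<integral>\<^sup>+t\<in>{-T..T}. dyadic_kernel s ((F u - F v) + t * (u - v)) \<partial>lborel)"
          unfolding N_def by (subst nn_integral_restrict_space) (auto simp: algebra_simps)
        also have "\<dots> \<le> ennreal (C * \<bar>u - v\<bar> powr (- p))" using elim by (intro C(2)) auto
        finally show ?case using C(1) by (simp add: ennreal_mult)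
      qed
    qed
    also have "\<dots> = ennreal C * (\<integral>\<^sup>+u. \<integral>\<^sup>+v. ennreal (\<bar>u - v\<bar> powr (- p)) \<partial>M \<partial>M)"
      by (simp add: nn_integral_cmult)
    also have "\<dots> < \<infinity>"
      using riesz_energy_unit_interval_finite[OF p(2)] by (simp add: M_def ennreal_mult_less_top)
    finally have fin: "(\<integral>\<^sup>+t. ?I t \<partial>N) \<noteq> \<infinity>" by simp
    have "AE t in N. ?I t \<noteq> \<infinity>"
      by (rule nn_integral_PInf_AE[OF _ fin]) measurable
    then have "AE t in N. hausdorff_measure s (?h t ` {0..<1}) \<noteq> 0"
    proof eventually_elim
      case (elim t)
      have "?h t \<in> borel_measurable M" by measurable
      from finite_energy_imp_hausdorff_measure_pos[OF M.sigma_finite_measure_axioms this pos s(1) elim]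
      show ?case by (simp add: space_M)
    qed
    then show ?thesis unfolding N_def by (subst (asm) AE_restrict_space_iff) auto
  qed
  \<comment> \<open>Countably many bounded ranges exhaust the line; \<open>Suc n\<close> keeps each
    bound positive.\<close>
  then have "AE t in lborel. \<forall>n. t \<in> {- real (Suc n)..real (Suc n)} \<longrightarrow>
      hausdorff_measure s ((\<lambda>u. F u + t * u) ` {0..<1}) \<noteq> 0"
    by (subst AE_all_countable) (intro allI, simp only: of_nat_0_less_iff)
  then show ?thesis
  proof eventually_elim
    case (elim t)
    obtain n where "\<bar>t\<bar> \<le> real n" using real_arch_simple by blast
    then have "t \<in> {- real (Suc n)..real (Suc n)}" by auto
    with elim show ?case by blast
  qed
qed

section \<open>Prevalence\<close>

theorem theorem2p1:
  assumes "compact (UNIV :: 'a::metric_space set)"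
    and "uncountable (UNIV :: 'a set)"
  shows "one_prevalent {f :: 'a \<Rightarrow>\<^sub>C real.
    hausdorff_dim (range (apply_bcontfun f)) = 1 \<and> packing_dim (range (apply_bcontfun f)) = 1}"
proof -
  define s where "s n = 1 - 1 / real (n + 2)" for n
  have s: "0 < s n" "s n < 1" for n by (auto simp: s_def)
  define S where "S = {f :: 'a \<Rightarrow>\<^sub>C real.
    hausdorff_dim (range (apply_bcontfun f)) = 1 \<and> packing_dim (range (apply_bcontfun f)) = 1}"
  have S_iff: "f \<in> S \<longleftrightarrow> (\<forall>n. hausdorff_measure (s n) (range (apply_bcontfun f)) \<noteq> 0)" for f
    by (simp add: S_def hausdorff_packing_dim_real_eq_1_iff s_def)
  have "S = (\<Inter>n. - {f. hausdorff_measure (s n) (range (apply_bcontfun f)) = 0})"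
    using S_iff by auto
  also have "\<dots> \<in> sets borel"
    using borel_hausdorff_measure_range_eq_0[OF assms(1) s(1), where 'b = real]
    by (intro sets.countable_INT'' borel_comp) auto
  finally have S_borel: "S \<in> sets borel" .
  obtain \<phi> :: "'a \<Rightarrow> real" and g :: "real \<Rightarrow> 'a" where \<phi>: "continuous_on UNIV \<phi>"
    and \<phi>g: "\<And>u. u \<in> {0..<1} \<Longrightarrow> \<phi> (g u) = u" and g: "g \<in> borel_measurable borel"
    using continuous_surjection_with_borel_section[OF assms] by blast
  define \<Phi> where "\<Phi> = Bcontfun \<phi>"
  have \<Phi>: "apply_bcontfun \<Phi> = \<phi>"
    unfolding \<Phi>_def by (intro Bcontfun_inverse compact_continuous_bcontfun assms(1) \<phi>)
  have "\<phi> (g (1/2)) = 1/2" by (rule \<phi>g) auto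
  then have "\<Phi> \<noteq> 0" using \<Phi> by auto
  moreover have "emeasure (line_measure \<Phi>) (UNIV - (\<lambda>x. x + y) ` S) = 0" for y
  proof -
    have translate: "UNIV - (\<lambda>x. x + y) ` S = (\<lambda>x. x - y) -` (- S)"
      by (force simp: image_iff algebra_simps)
    have "(\<lambda>x. x - y) \<in> borel_measurable borel"
      by (intro borel_measurable_continuous_onI continuous_intros)
    then have meas: "UNIV - (\<lambda>x. x + y) ` S \<in> sets borel"
      unfolding translate using S_borel measurable_sets_borel by (metis borel_comp)
    have "(\<lambda>t. t *\<^sub>R \<Phi>) \<in> borel_measurable borel"
      by (intro borel_measurable_continuous_onI continuous_intros)
    then have line: "(\<lambda>t. t *\<^sub>R \<Phi>) \<in> borel_measurable lborel" by simp
    \<comment> \<open>Translating by \<open>y\<close> replaces the point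
      \<open>t *\<^sub>R \<Phi>\<close> of the probe by \<open>t *\<^sub>R \<Phi> - y\<close>. Along
      \<open>g\<close> this function takes the value \<open>t * u\<close> minus that of
      \<open>y\<close> at \<open>g u\<close>, so the energy result applies with the Borel function
      \<open>F\<close> given by \<open>- apply_bcontfun y (g u)\<close>.\<close>
    have "AE t in lborel. hausdorff_measure (s n) ((\<lambda>u. - apply_bcontfun y (g u) + t * u) ` {0..<1}) \<noteq> 0" for n
    proof (rule AE_hausdorff_measure_image_pos[OF _ s])
      have "apply_bcontfun y \<in> borel_measurable borel"
        by (intro borel_measurable_continuous_onI) auto
      then show "(\<lambda>u. - apply_bcontfun y (g u)) \<in> borel_measurable borel"
        using measurable_compose[OF g] by (intro borel_measurable_uminus) blast
    qed
    then have "AE t in lborel. \<forall>n. hausdorff_measure (s n)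
        ((\<lambda>u. - apply_bcontfun y (g u) + t * u) ` {0..<1}) \<noteq> 0"
      by (subst AE_all_countable) blast
    then have AE: "AE t in lborel. t *\<^sub>R \<Phi> \<notin> UNIV - (\<lambda>x. x + y) ` S"
    proof eventually_elim
      case (elim t)
      \<comment> \<open>An inclusion is enough: if the full range were null, so would be this
        subset.\<close>
      have "(\<lambda>u. - apply_bcontfun y (g u) + t * u) ` {0..<1} \<subseteq> range (apply_bcontfun (t *\<^sub>R \<Phi> - y))"
      proof safe
        fix u :: real assume "u \<in> {0..<1}"
        then have "- apply_bcontfun y (g u) + t * u = apply_bcontfun (t *\<^sub>R \<Phi> - y) (g u)"
          by (simp add: \<Phi> \<phi>g)
        then show "- apply_bcontfun y (g u) + t * u \<in> range (apply_bcontfun (t *\<^sub>R \<Phi> - y))"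
          by (rule range_eqI)
      qed
      then have "t *\<^sub>R \<Phi> - y \<in> S"
        unfolding S_iff using elim hausdorff_measure_eq_0_subset by blast
      then show ?case unfolding translate by simp
    qed
    have "emeasure (line_measure \<Phi>) (UNIV - (\<lambda>x. x + y) ` S) =
        emeasure lborel ((\<lambda>t. t *\<^sub>R \<Phi>) -` (UNIV - (\<lambda>x. x + y) ` S) \<inter> space lborel)"
      unfolding line_measure_def by (rule emeasure_distr[OF line meas])
    also have "\<dots> = 0"
      using AE measurable_sets[OF line meas]
      by (subst (asm) AE_iff_measurable[OF _ refl]) (auto simp: vimage_def Int_def)
    finally show ?thesis .
  qed
  ultimately have "is_probe \<Phi> S" by (simp add: is_probe_def)
  with S_borel show ?thesis unfolding one_prevalent_def S_def by blast
qed

end
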